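(* The following equalities hold: (i) $\mathcal{U}_2=\Phi^{-1}(\mathcal{U}'_2)\cup\mathcal{C}$. (ii) $\mathcal{V}_2=\Phi^{-1}(\mathcal{V}'_2\setminus\mathcal{C}')\cup\mathcal{C}$. (iii) $\overline{\mathcal{U}_2}=\Phi^{-1}(\overline{\mathcal{U}'_2}\setminus\mathcal{C}')\cup\mathcal{C}$.
   Context: $\mathbb{N}=\{1,2,\dots\}$, $\mathbb{N}_0=\mathbb{N}\cup\{0\}$. $\Sigma_2=\{0,1\}^{\mathbb{N}}$; $\Sigma_2^0$ and $\Sigma_2^1$ are the sets of sequences $(d_i)\in\Sigma_2$ with $d_1=0$ and $d_1=1$, respectively. $\sigma((d_i))=(d_{i+1})$ is the left shift. $\prec,\preccurlyeq,\succ,\succcurlyeq$ refer to the lexicographic order. For a finite word $w$, $w^\infty$ is its infinite repetition. A sequence $(d_i)\in\Sigma_2$ is finite if there is $K\in\mathbb{N}$ with $d_K=1$ and $d_k=0$ for all $k>K$, and infinite otherwise; it is co-finite if $(1-d_i)$ is finite, and co-infinite otherwise (so $0^\infty$ and $1^\infty$ are both infinite and co-infinite). Throughout, pairs $(q_0,q_1)\in(1,\infty)^2$ are assumed to satisfy $q_0+q_1\ge q_0q_1$. A double-base expansion of a real number $x$ is a sequence $(d_i)\in\Sigma_2$ with $$x=\pi_{q_0,q_1}((d_i)):=\sum_{i=1}^\infty\frac{d_i}{q_{d_1}q_{d_2}\cdots q_{d_i}}.$$ Put $\ell_{q_0,q_1}=\frac{q_1}{q_0(q_1-1)}-1$ and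 $r_{q_0,q_1}=\frac{q_0}{q_1}$. Let $\mu(q_0,q_1)$ be the lexicographically smallest co-infinite double-base expansion of $\ell_{q_0,q_1}$, and $\alpha(q_0,q_1)$ the lexicographically largest infinite double-base expansion of $r_{q_0,q_1}$. Define $$\mathcal{B}=\{(q_0,q_1)\in(1,\infty)^2: q_0+q_1>q_0q_1\},\qquad \mathcal{C}=\{(q_0,q_1)\in(1,\infty)^2: q_0+q_1=q_0q_1\}.$$ Let $\mathcal{C}'$ be the set of pairs $(\mu,\alpha)\in\Sigma_2^0\times\Sigma_2^1$ such that $\mu=0^\infty$, or $\mu=x_1\cdots x_m1^\infty$ for some $m\in\mathbb{N}$, $x_i\in\{0,1\}$, $x_m=0$, or $\alpha=1^\infty$, or $\alpha=y_1\cdots y_n0^\infty$ for some $n\in\mathbb{N}$, $y_j\in\{0,1\}$, $y_n=1$. Let $$\mathcal{B}'=\{(\mu,\alpha)\in(\Sigma_2^0\times\Sigma_2^1)\setminus\mathcal{C}':\ \mu\preccurlyeq\sigma^m(\mu)\text{ and }\sigma^n(\alpha)\preccurlyeq\alpha\text{ for all }m,n\in\mathbb{N}_0\}.$$ The map $\Phi:\mathcal{B}\to\mathcal{B}'$, $\Phi((q_0,q_1))=(\mu(q_0,q_1),\alpha(q_0,q_1))$, is a bijection, and $\Phi^{-1}:\mathcal{B}'\to\mathcal{B}$ is its inverse. Sets of bases: $\mathcal{U}_2$ is the set of $(q_0,q_1)\in(1,\infty)^2$ (with $q_0+q_1\ge q_0q_1$) such that both $\ell_{q_0,q_1}$ and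 $r_{q_0,q_1}$ have a unique double-base expansion; $\overline{\mathcal{U}_2}$ is its topological closure with respect to the max metric on $\mathbb{R}^2$; $\mathcal{V}_2$ is the set of $(q_0,q_1)\in(1,\infty)^2$ (with $q_0+q_1\ge q_0q_1$) such that $\sigma^m(\mu(q_0,q_1))\preccurlyeq\alpha(q_0,q_1)$ and $\sigma^n(\alpha(q_0,q_1))\succcurlyeq\mu(q_0,q_1)$ for all $m,n\in\mathbb{N}_0$. Sets of sequences: $$\mathcal{U}'_2=\{(\mu,\alpha)\in\Sigma_2^0\times\Sigma_2^1:\ \mu\prec\sigma^m(\mu)\prec\alpha,\ \mu\prec\sigma^n(\alpha)\prec\alpha\text{ for all }m,n\in\mathbb{N}\},$$ $$\mathcal{V}'_2=\{(\mu,\alpha)\in\Sigma_2^0\times\Sigma_2^1:\ \mu\preccurlyeq\sigma^m(\mu)\preccurlyeq\alpha,\ \mu\preccurlyeq\sigma^n(\alpha)\preccurlyeq\alpha\text{ for all }m,n\in\mathbb{N}_0\},$$ and $\overline{\mathcal{U}'_2}$ is the closure of $\mathcal{U}'_2$ in $\Sigma_2\times\Sigma_2$, where $\Sigma_2$ carries the metric $d((c_i),(e_i))=2^{-\min\{i:c_i\ne e_i\}}$ for distinct sequences, and $\Sigma_2\times\Sigma_2$ the max of the coordinate metrics. *)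

theory Defs
  imports "HOL-Analysis.Analysis" "HOL-Library.Fun_Lexorder"
begin

text \<open>
  Binary sequences are functions \<open>nat \<Rightarrow> bool\<close>, with \<open>True\<close> for the digit 1. They are indexed
  from 0, so the digit \<open>d\<^sub>i\<close> of the usual notation is \<open>d (i - 1)\<close>.
  Their strict lexicographic order is the library's \<open>less_fun\<close>; note that \<open><\<close> and \<open>\<le>\<close> on
  functions are pointwise and are not used for sequences.
\<close>

type_synonym bseq = "nat \<Rightarrow> bool"

abbreviation lex_less :: "bseq \<Rightarrow> bseq \<Rightarrow> bool"  (infix "\<prec>\<^sub>l" 50)
  where "c \<prec>\<^sub>l e \<equiv> less_fun c e"

definition lex_le :: "bseq \<Rightarrow> bseq \<Rightarrow> bool"  (infix "\<preceq>\<^sub>l" 50)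
  where "c \<preceq>\<^sub>l e \<longleftrightarrow> c \<prec>\<^sub>l e \<or> c = e"

definition shift :: "bseq \<Rightarrow> bseq"
  where "shift d = (\<lambda>i. d (Suc i))"

definition Sigma0 :: "bseq set"
  where "Sigma0 = {d. \<not> d 0}"

definition Sigma1 :: "bseq set"
  where "Sigma1 = {d. d 0}"

definition finite_seq :: "bseq \<Rightarrow> bool"
  where "finite_seq d \<longleftrightarrow> (\<exists>K. d K \<and> (\<forall>k>K. \<not> d k))"

definition cofinite_seq :: "bseq \<Rightarrow> bool"
  where "cofinite_seq d \<longleftrightarrow> finite_seq (\<lambda>i. \<not> d i)"

definition dbe_value :: "real \<Rightarrow> real \<Rightarrow> bseq \<Rightarrow> real"
  where "dbe_value q0 q1 d = (\<Sum>i. of_bool (d i) / (\<Prod>j\<le>i. if d j then q1 else q0))"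

definition dbe :: "real \<Rightarrow> real \<Rightarrow> real \<Rightarrow> bseq set"
  where "dbe q0 q1 x = {d. dbe_value q0 q1 d = x}"

lemma dbe_summable:
  assumes "1 < q0" "1 < q1"
  shows "summable (\<lambda>i. of_bool (d i) / (\<Prod>j\<le>i. if d j then q1 else q0) :: real)"
proof (rule summable_comparison_test')
  define q where "q = min q0 q1"
  have q: "1 < q" using assms by (simp add: q_def)
  show "summable (\<lambda>i. (1 / q) ^ Suc i)"
    using q by (subst summable_Suc_iff) (simp add: summable_geometric)
  fix i :: nat
  have "q ^ Suc i = (\<Prod>j\<le>i. q)" by simp
  also have "\<dots> \<le> (\<Prod>j\<le>i. if d j then q1 else q0)"
    using q by (intro prod_mono) (auto simp: q_def)
  finally have le: "q ^ Suc i \<le> (\<Prod>j\<le>i. if d j then q1 else q0)" .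
  have pos: "0 < q ^ Suc i" using q by (intro zero_less_power) simp
  have "norm (of_bool (d i) / (\<Prod>j\<le>i. if d j then q1 else q0) :: real)
      \<le> 1 / (\<Prod>j\<le>i. if d j then q1 else q0)"
    using le pos by (simp add: divide_right_mono)
  also have "\<dots> \<le> 1 / q ^ Suc i"
    using le pos by (intro divide_left_mono) (auto intro: mult_pos_pos)
  finally show "norm (of_bool (d i) / (\<Prod>j\<le>i. if d j then q1 else q0) :: real) \<le> (1 / q) ^ Suc i"
    by (simp add: power_one_over)
qed

definition ell :: "real \<Rightarrow> real \<Rightarrow> real"
  where "ell q0 q1 = q1 / (q0 * (q1 - 1)) - 1"

definition arr :: "real \<Rightarrow> real \<Rightarrow> real"
  where "arr q0 q1 = q0 / q1"

definition mu_seq :: "real \<Rightarrow> real \<Rightarrow> bseq"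
  where "mu_seq q0 q1 =
    (THE d. d \<in> dbe q0 q1 (ell q0 q1) \<and> \<not> cofinite_seq d \<and>
       (\<forall>e \<in> dbe q0 q1 (ell q0 q1). \<not> cofinite_seq e \<longrightarrow> d \<preceq>\<^sub>l e))"

definition alpha_seq :: "real \<Rightarrow> real \<Rightarrow> bseq"
  where "alpha_seq q0 q1 =
    (THE d. d \<in> dbe q0 q1 (arr q0 q1) \<and> \<not> finite_seq d \<and>
       (\<forall>e \<in> dbe q0 q1 (arr q0 q1). \<not> finite_seq e \<longrightarrow> e \<preceq>\<^sub>l d))"

definition baseB :: "(real \<times> real) set"
  where "baseB = {(q0, q1). 1 < q0 \<and> 1 < q1 \<and> q0 + q1 > q0 * q1}"

definition baseC :: "(real \<times> real) set"
  where "baseC = {(q0, q1). 1 < q0 \<and> 1 < q1 \<and> q0 + q1 = q0 * q1}"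

text \<open>
  The existential conditions say that \<open>\<mu>\<close> is a finite word ending in 0 followed by \<open>1\<^sup>\<infinity>\<close>,
  and that \<open>\<alpha>\<close> is a finite word ending in 1 followed by \<open>0\<^sup>\<infinity>\<close>.
\<close>

definition seqC :: "(bseq \<times> bseq) set"
  where "seqC = {(\<mu>, \<alpha>). \<mu> \<in> Sigma0 \<and> \<alpha> \<in> Sigma1 \<and>
     (\<mu> = (\<lambda>_. False) \<or> (\<exists>m. \<not> \<mu> m \<and> (\<forall>k>m. \<mu> k)) \<or>
      \<alpha> = (\<lambda>_. True) \<or> (\<exists>n. \<alpha> n \<and> (\<forall>k>n. \<not> \<alpha> k)))}"

definition seqB :: "(bseq \<times> bseq) set"
  where "seqB = {(\<mu>, \<alpha>). (\<mu>, \<alpha>) \<in> (Sigma0 \<times> Sigma1) - seqC \<and>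
     (\<forall>m. \<mu> \<preceq>\<^sub>l (shift ^^ m) \<mu>) \<and> (\<forall>n. (shift ^^ n) \<alpha> \<preceq>\<^sub>l \<alpha>)}"

definition Phi :: "real \<times> real \<Rightarrow> bseq \<times> bseq"
  where "Phi = (\<lambda>(q0, q1). (mu_seq q0 q1, alpha_seq q0 q1))"

text \<open>
  \<open>Phi\<close> maps \<open>baseB\<close> bijectively onto \<open>seqB\<close>, and this is its inverse. The values outside
  \<open>Phi ` baseB\<close> are unspecified.
\<close>

definition Phi_inv :: "bseq \<times> bseq \<Rightarrow> real \<times> real"
  where "Phi_inv = inv_into baseB Phi"

definition baseU :: "(real \<times> real) set"
  where "baseU = {(q0, q1). 1 < q0 \<and> 1 < q1 \<and> q0 + q1 \<ge> q0 * q1 \<and>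
     (\<exists>!d. d \<in> dbe q0 q1 (ell q0 q1)) \<and> (\<exists>!d. d \<in> dbe q0 q1 (arr q0 q1))}"

definition baseV :: "(real \<times> real) set"
  where "baseV = {(q0, q1). 1 < q0 \<and> 1 < q1 \<and> q0 + q1 \<ge> q0 * q1 \<and>
     (\<forall>m. (shift ^^ m) (mu_seq q0 q1) \<preceq>\<^sub>l alpha_seq q0 q1) \<and>
     (\<forall>n. mu_seq q0 q1 \<preceq>\<^sub>l (shift ^^ n) (alpha_seq q0 q1))}"

definition seqU :: "(bseq \<times> bseq) set"
  where "seqU = {(\<mu>, \<alpha>). \<mu> \<in> Sigma0 \<and> \<alpha> \<in> Sigma1 \<and>
     (\<forall>m\<ge>1. \<mu> \<prec>\<^sub>l (shift ^^ m) \<mu> \<and> (shift ^^ m) \<mu> \<prec>\<^sub>l \<alpha>) \<and>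
     (\<forall>n\<ge>1. \<mu> \<prec>\<^sub>l (shift ^^ n) \<alpha> \<and> (shift ^^ n) \<alpha> \<prec>\<^sub>l \<alpha>)}"

definition seqV :: "(bseq \<times> bseq) set"
  where "seqV = {(\<mu>, \<alpha>). \<mu> \<in> Sigma0 \<and> \<alpha> \<in> Sigma1 \<and>
     (\<forall>m. \<mu> \<preceq>\<^sub>l (shift ^^ m) \<mu> \<and> (shift ^^ m) \<mu> \<preceq>\<^sub>l \<alpha>) \<and>
     (\<forall>n. \<mu> \<preceq>\<^sub>l (shift ^^ n) \<alpha> \<and> (shift ^^ n) \<alpha> \<preceq>\<^sub>l \<alpha>)}"

text \<open>The exponent is shifted by one because sequences are indexed from 0 here.\<close>

definition seq_dist :: "bseq \<Rightarrow> bseq \<Rightarrow> real"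
  where "seq_dist c e = (if c = e then 0 else (1 / 2) ^ Suc (LEAST i. c i \<noteq> e i))"

definition max_dist :: "('a \<Rightarrow> 'a \<Rightarrow> real) \<Rightarrow> ('b \<Rightarrow> 'b \<Rightarrow> real) \<Rightarrow> 'a \<times> 'b \<Rightarrow> 'a \<times> 'b \<Rightarrow> real"
  where "max_dist d1 d2 = (\<lambda>(a, b) (a', b'). max (d1 a a') (d2 b b'))"

abbreviation seq_closure :: "(bseq \<times> bseq) set \<Rightarrow> (bseq \<times> bseq) set"
  where "seq_closure S \<equiv> Metric_space.mtopology UNIV (max_dist seq_dist seq_dist) closure_of S"

abbreviation base_closure :: "(real \<times> real) set \<Rightarrow> (real \<times> real) set"
  where "base_closure S \<equiv> Metric_space.mtopology UNIV (max_dist dist dist) closure_of S"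

lemma Metric_space_max_dist:
  assumes "Metric_space UNIV d1" "Metric_space UNIV d2"
  shows "Metric_space UNIV (max_dist d1 d2)"
proof -
  interpret A: Metric_space UNIV d1 by fact
  interpret B: Metric_space UNIV d2 by fact
  show ?thesis
  proof
    fix x y z
    show "0 \<le> max_dist d1 d2 x y"
      by (auto simp: max_dist_def le_max_iff_disj split: prod.splits)
    show "max_dist d1 d2 x y = max_dist d1 d2 y x"
      by (auto simp: max_dist_def A.commute B.commute split: prod.splits)
    show "max_dist d1 d2 x y = 0 \<longleftrightarrow> x = y"
    proof (cases x; cases y)
      fix a b a' b' assume xy: "x = (a, b)" "y = (a', b')"
      have "max (d1 a a') (d2 b b') = 0 \<longleftrightarrow> d1 a a' = 0 \<and> d2 b b' = 0"
        using A.nonneg[of a a'] B.nonneg[of b b'] by linarith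
      then show ?thesis
        by (simp add: max_dist_def xy)
    qed
    show "max_dist d1 d2 x z \<le> max_dist d1 d2 x y + max_dist d1 d2 y z"
    proof (cases x; cases y; cases z)
      fix a b a' b' a'' b'' assume "x = (a, b)" "y = (a', b')" "z = (a'', b'')"
      then show ?thesis
        using A.triangle[of a a' a''] B.triangle[of b b' b'']
        by (auto simp: max_dist_def)
    qed
  qed
qed

lemma Metric_space_seq_dist: "Metric_space UNIV seq_dist"
proof
  fix x y z :: bseq
  show "0 \<le> seq_dist x y" by (simp add: seq_dist_def)
  have "(\<lambda>i. x i \<noteq> y i) = (\<lambda>i. y i \<noteq> x i)" by auto
  then show "seq_dist x y = seq_dist y x" by (simp add: seq_dist_def)
  show "seq_dist x y = 0 \<longleftrightarrow> x = y" by (simp add: seq_dist_def)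
  show "seq_dist x z \<le> seq_dist x y + seq_dist y z"
  proof (cases "x = y \<or> y = z \<or> x = z")
    case True
    then show ?thesis by (auto simp: seq_dist_def)
  next
    case False
    define L where "L = (\<lambda>c e :: bseq. LEAST i. c i \<noteq> e i)"
    have L_le: "L c e \<le> i" if "c i \<noteq> e i" for c e :: bseq and i
      unfolding L_def using that by (rule Least_le)
    have dist_L: "seq_dist c e = (1 / 2) ^ Suc (L c e)" if "c \<noteq> e" for c e
      using that by (simp add: seq_dist_def L_def)
    obtain k where "x k \<noteq> z k" using False by auto
    then have "x (L x z) \<noteq> z (L x z)"
      unfolding L_def by (rule LeastI)
    then have "x (L x z) \<noteq> y (L x z) \<or> y (L x z) \<noteq> z (L x z)" by auto
    then have "L x y \<le> L x z \<or> L y z \<le> L x z"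
      using L_le[of x "L x z" y] L_le[of y "L x z" z] by argo
    then have "seq_dist x z \<le> seq_dist x y \<or> seq_dist x z \<le> seq_dist y z"
      using False by (simp add: dist_L del: power_Suc)
    moreover have "0 \<le> seq_dist x y" "0 \<le> seq_dist y z"
      by (simp_all add: seq_dist_def)
    ultimately show ?thesis by linarith
  qed
qed

lemma base_closure_eq: "base_closure S = closure S"
proof -
  interpret M: Metric_space UNIV "max_dist dist dist :: real \<times> real \<Rightarrow> real \<times> real \<Rightarrow> real"
    by (intro Metric_space_max_dist Met_TC.Metric_space_axioms)
  have le: "max_dist dist dist x y \<le> dist x y" for x y :: "real \<times> real"
    by (cases x; cases y)
      (auto simp: max_dist_def dist_prod_def real_le_rsqrt)
  have ge: "dist x y \<le> 2 * max_dist dist dist x y" for x y :: "real \<times> real"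
  proof (cases x; cases y)
    fix a b a' b' assume xy: "x = (a, b)" "y = (a', b')"
    have "dist x y \<le> dist a a' + dist b b'"
      by (simp add: xy dist_prod_def sqrt_sum_squares_le_sum)
    then show ?thesis by (simp add: xy max_dist_def)
  qed
  show ?thesis
  proof (intro set_eqI iffI)
    fix x assume "x \<in> base_closure S"
    then have *: "\<exists>y\<in>S. max_dist dist dist x y < r" if "r > 0" for r
      using that by (auto simp: M.metric_closure_of)
    show "x \<in> closure S"
      unfolding closure_approachable
    proof (intro allI impI)
      fix e :: real assume "e > 0"
      then obtain y where "y \<in> S" "max_dist dist dist x y < e / 2" using *[of "e / 2"] by auto
      then show "\<exists>y\<in>S. dist y x < e" using ge[of x y] by (auto simp: dist_commute intro!: bexI[of _ y])
    qed
  next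
    fix x assume "x \<in> closure S"
    show "x \<in> base_closure S"
      unfolding M.metric_closure_of
    proof (intro CollectI conjI UNIV_I allI impI)
      fix r :: real assume "r > 0"
      then obtain y where "y \<in> S" "dist x y < r"
        using \<open>x \<in> closure S\<close> by (auto simp: closure_approachable dist_commute)
      then show "\<exists>y\<in>S. y \<in> M.mball x r"
        using le_less_trans[OF le[of x y]] by (auto intro!: bexI[of _ y])
    qed
  qed
qed

end

theory Submission
  imports Defs "HOL-Library.Diagonal_Subsequence"
begin

text \<open>
  Scale the value of a sequence by \<open>q1 - 1\<close>. Prefixing the digit 0 then acts on the unit interval as
  \<open>w \<mapsto> w / q0\<close> and prefixing the digit 1 as \<open>w \<mapsto> 1 - (1 - w) / q1\<close>. In this scale \<open>r\<close> becomes a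
  threshold \<open>R\<close> and \<open>\<ell>\<close> becomes \<open>L = 1 - R'\<close>, where \<open>R'\<close> is the threshold of the bases in the opposite
  order. Exchanging digits and bases reverses the interval, so \<open>\<mu>(q0, q1)\<close> is the digitwise negation of
  \<open>\<alpha>(q1, q0)\<close> (\<open>mu_seq_eq_flip\<close>), and only \<open>\<alpha>\<close> has to be studied.

  Lexicographic conditions turn into conditions on remainders. A remainder in the closed overlap of
  the two branches allows both digits; an expansion is therefore unique exactly if every remainder
  behind a digit 0 is below \<open>R\<close> and every remainder behind a digit 1 is above \<open>L\<close>. For \<open>\<mu>\<close> and \<open>\<alpha>\<close>,
  at bases off the curve \<open>\<C>\<close>, this says the same as \<open>\<mu> \<prec> \<sigma>\<^sup>m(\<mu>) \<prec> \<alpha>\<close> and \<open>\<mu> \<prec> \<sigma>\<^sup>n(\<alpha>) \<prec> \<alpha>\<close>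
  (\<open>seqU_iff_univoque\<close>). The step from sequences to values is \<open>nval_le_thr_if_dominated\<close>: an excess of
  value over \<open>R\<close> would be enlarged again and again along the tails.

  The map \<open>\<Phi>\<close> is inverted by solving equations. With \<open>\<alpha> = 1 a\<close> and \<open>\<mu> = 0 c\<close>, a pair \<open>(\<mu>, \<alpha>)\<close> of
  \<open>seqB\<close> is \<open>\<Phi>(q0, q1)\<close> iff \<open>a\<close> in the bases \<open>(q0, q1)\<close> and the negation of \<open>c\<close> in the bases
  \<open>(q1, q0)\<close> both have the scaled value \<open>(q0 - 1) (q1 - 1)\<close>. Uniqueness of the solution is
  a monotonicity argument (\<open>solves_unique\<close>) and existence follows from Brouwer's theorem
  (\<open>ex_solves\<close>). The first two equalities follow from the bijectivity of \<open>\<Phi>\<close>,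
  since on the curve \<open>\<C>\<close> one has \<open>\<mu> = 0\<^sup>\<infinity>\<close> and \<open>\<alpha> = 1\<^sup>\<infinity>\<close>.

  For the closures, the scaled value is jointly continuous in the bases and the sequence
  (\<open>nval_tendsto\<close>), so limits of solutions are solutions (\<open>solves_limit\<close>). From bases to
  sequences, compactness of the sequence space provides limit pairs, which cannot lie in \<open>seqC\<close> because
  within \<open>seqV\<close> that would make \<open>\<mu>\<close> or \<open>\<alpha>\<close> constant. From sequences to bases, compactness of a square
  \<open>[1 + \<delta>, 1 + 1/\<delta>]\<^sup>2\<close> is used; \<open>base_lower_bound\<close> supplies a \<open>\<delta>\<close> that depends only on a common
  prefix. Finally, no limit of univoque bases has a coordinate 1, by the inequality \<open>baseU_lower\<close>.
\<close>

section \<open>Binary sequences\<close>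

lemma lex_less_iff: "c \<prec>\<^sub>l e \<longleftrightarrow> (\<exists>k. \<not> c k \<and> e k \<and> (\<forall>i<k. c i = e i))"
  by (auto simp: less_fun_def)

lemma lex_cases: "c \<prec>\<^sub>l e \<or> c = e \<or> e \<prec>\<^sub>l c"
proof (cases "c = e")
  case False
  then obtain k where k: "c k \<noteq> e k" by auto
  define m where "m = (LEAST k. c k \<noteq> e k)"
  have "c m \<noteq> e m" unfolding m_def using k by (rule LeastI)
  moreover have "c i = e i" if "i < m" for i
    using not_less_Least[of i "\<lambda>k. c k \<noteq> e k"] that unfolding m_def by blast
  ultimately have "(\<not> c m \<and> e m \<or> \<not> e m \<and> c m) \<and> (\<forall>i<m. c i = e i)" by auto
  then show ?thesis unfolding lex_less_iff by metis
qed simp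

lemma lex_le_iff_not_less: "c \<preceq>\<^sub>l e \<longleftrightarrow> \<not> e \<prec>\<^sub>l c"
  using lex_cases[of c e] less_fun_asym less_fun_irrefl by (auto simp: lex_le_def)

lemma funpow_shift: "(shift ^^ n) d = (\<lambda>i. d (n + i))"
proof (induction n)
  case (Suc n)
  then show ?case by (simp add: shift_def)
qed simp

definition flip :: "bseq \<Rightarrow> bseq"
  where "flip d = (\<lambda>i. \<not> d i)"

lemma flip_flip [simp]: "flip (flip d) = d"
  by (simp add: flip_def)

lemma flip_eq_iff [simp]: "flip c = flip e \<longleftrightarrow> c = e"
  by (metis flip_flip)

lemma lex_less_flip [simp]: "flip c \<prec>\<^sub>l flip e \<longleftrightarrow> e \<prec>\<^sub>l c"
  unfolding lex_less_iff flip_def by blast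

lemma lex_le_flip [simp]: "flip c \<preceq>\<^sub>l flip e \<longleftrightarrow> e \<preceq>\<^sub>l c"
  by (simp add: lex_le_iff_not_less)

lemma shift_flip: "shift (flip d) = flip (shift d)"
  by (simp add: shift_def flip_def)

lemma funpow_shift_flip: "(shift ^^ n) (flip d) = flip ((shift ^^ n) d)"
  by (simp add: funpow_shift flip_def)

lemma finite_seq_flip: "finite_seq (flip d) \<longleftrightarrow> cofinite_seq d"
  by (simp add: flip_def cofinite_seq_def)

lemma infinite_seqD:
  assumes "\<not> finite_seq d" "d k"
  shows "(shift ^^ Suc k) d \<noteq> (\<lambda>_. False)"
proof
  assume "(shift ^^ Suc k) d = (\<lambda>_. False)"
  then have "\<not> d (Suc k + i)" for i by (metis funpow_shift)
  then have "\<not> d j" if "j > k" for j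
    using that by (metis Suc_leI le_Suc_ex)
  then show False using assms unfolding finite_seq_def by blast
qed

lemma finite_seq_shift_pow:
  assumes "finite_seq ((shift ^^ n) d)"
  shows "finite_seq d"
proof -
  obtain K where K: "d (n + K)" "\<And>k. k > K \<Longrightarrow> \<not> d (n + k)"
    using assms by (auto simp: finite_seq_def funpow_shift)
  have "\<not> d k" if "k > n + K" for k
    using K(2)[of "k - n"] that by simp
  then show ?thesis unfolding finite_seq_def using K(1) by blast
qed

section \<open>The normalised value of a sequence\<close>

text \<open>The factor makes \<open>1\<^sup>\<infinity>\<close> the sequence of value 1, whatever the bases are.\<close>

definition nval :: "real \<Rightarrow> real \<Rightarrow> bseq \<Rightarrow> real"
  where "nval q0 q1 d = (q1 - 1) * dbe_value q0 q1 d"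

lemma dbe_value_rec:
  assumes "1 < q0" "1 < q1"
  shows "dbe_value q0 q1 d = (if d 0 then (1 + dbe_value q0 q1 (shift d)) / q1
    else dbe_value q0 q1 (shift d) / q0)"
proof -
  define g where "g d = (\<lambda>i. of_bool (d i) / (\<Prod>j\<le>i. if d j then q1 else q0) :: real)" for d :: bseq
  define b where "b = (if d 0 then q1 else q0)"
  have sm: "summable (g e)" for e unfolding g_def using dbe_summable[OF assms] .
  have v: "dbe_value q0 q1 e = suminf (g e)" for e by (simp add: dbe_value_def g_def)
  have "g d (Suc i) = g (shift d) i / b" for i
    by (simp add: g_def b_def shift_def prod.atMost_Suc_shift del: prod.atMost_Suc)
  then have "(\<Sum>i. g d (Suc i)) = suminf (g (shift d)) / b"
    using suminf_divide[OF sm[of "shift d"], of b] by simp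
  moreover have "suminf (g d) = (\<Sum>i. g d (Suc i)) + g d 0"
    using suminf_split_head[OF sm[of d]] by simp
  ultimately show ?thesis
    using assms by (simp add: v g_def b_def add_divide_distrib)
qed

lemma nval_rec:
  assumes "1 < q0" "1 < q1"
  shows "nval q0 q1 d = (if d 0 then 1 - (1 - nval q0 q1 (shift d)) / q1
    else nval q0 q1 (shift d) / q0)"
  using assms unfolding nval_def
  by (subst dbe_value_rec[OF assms]) (auto simp: field_simps)

lemma nval_nonneg:
  assumes "1 < q0" "1 < q1"
  shows "0 \<le> nval q0 q1 d"
proof -
  have "0 \<le> (\<Prod>j\<le>i. if d j then q1 else q0)" for i
    using assms by (intro prod_nonneg) auto
  then have "0 \<le> dbe_value q0 q1 d"
    unfolding dbe_value_def by (intro suminf_nonneg dbe_summable[OF assms]) simp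
  then show ?thesis using assms by (simp add: nval_def)
qed

lemma dbe_term_bound:
  fixes c q0 q1 :: real
  assumes c: "1 < c" "c \<le> q0" "c \<le> q1"
  shows "\<bar>of_bool (d n) / (\<Prod>j\<le>n. if d j then q1 else q0)\<bar> \<le> (1 / c) ^ Suc n"
proof -
  have "c ^ Suc n = (\<Prod>j\<le>n. c)" by simp
  also have "\<dots> \<le> (\<Prod>j\<le>n. if d j then q1 else q0)"
    using c by (intro prod_mono) auto
  finally have le: "c ^ Suc n \<le> (\<Prod>j\<le>n. if d j then q1 else q0)" .
  have pos: "0 < c ^ Suc n" using c by simp
  have "\<bar>of_bool (d n) / (\<Prod>j\<le>n. if d j then q1 else q0)\<bar> \<le> 1 / (\<Prod>j\<le>n. if d j then q1 else q0)"
    using le pos by (simp add: divide_right_mono)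
  also have "\<dots> \<le> 1 / c ^ Suc n"
    using le pos by (intro divide_left_mono) (auto intro: mult_pos_pos)
  finally show ?thesis by (simp add: power_one_over)
qed

lemma summable_geometric_Suc:
  assumes "1 < (c::real)"
  shows "summable (\<lambda>n. (1 / c) ^ Suc n)"
  using assms by (subst summable_Suc_iff) (simp add: summable_geometric)

lemma dbe_value_bounded:
  assumes q: "1 < q0" "1 < q1"
  obtains C where "\<And>e. dbe_value q0 q1 e \<le> C"
proof -
  define c where "c = min q0 q1"
  have c: "1 < c" "c \<le> q0" "c \<le> q1" using q by (auto simp: c_def)
  have "dbe_value q0 q1 e \<le> (\<Sum>n. (1 / c) ^ Suc n)" for e
    unfolding dbe_value_def
    by (intro suminf_le dbe_summable[OF q] summable_geometric_Suc c(1) abs_le_D1[OF dbe_term_bound[OF c]])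
  then show ?thesis using that by blast
qed

text \<open>The two digit maps are contractions with a common factor below 1, so a bounded orbit of
  remainders that follows the digits of \<open>d\<close> must start at the value of \<open>d\<close>.\<close>

lemma nval_eqI:
  assumes q: "1 < q0" "1 < q1"
    and bdd: "\<And>n. \<bar>x n\<bar> \<le> M"
    and step: "\<And>n. x n = (if d n then 1 - (1 - x (Suc n)) / q1 else x (Suc n) / q0)"
  shows "x 0 = nval q0 q1 d"
proof -
  define q where "q = min q0 q1"
  have q1: "1 < q" using q by (simp add: q_def)
  define D where "D n = \<bar>x n - nval q0 q1 ((shift ^^ n) d)\<bar>" for n
  obtain C where C: "\<And>e. dbe_value q0 q1 e \<le> C" using dbe_value_bounded[OF q] by blast
  have D_bdd: "D n \<le> M + (q1 - 1) * C" for n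
  proof -
    have "nval q0 q1 ((shift ^^ n) d) \<le> (q1 - 1) * C"
      unfolding nval_def using C q by (intro mult_left_mono) auto
    then show ?thesis
      using nval_nonneg[OF q, of "(shift ^^ n) d"] bdd[of n] unfolding D_def by linarith
  qed
  have D_step: "D n \<le> D (Suc n) / q" for n
  proof -
    define w where "w = nval q0 q1 ((shift ^^ Suc n) d)"
    have "nval q0 q1 ((shift ^^ n) d) = (if d n then 1 - (1 - w) / q1 else w / q0)"
      by (subst nval_rec[OF q]) (simp add: w_def funpow_shift shift_def)
    then have "x n - nval q0 q1 ((shift ^^ n) d) = (x (Suc n) - w) / (if d n then q1 else q0)"
      by (subst step[of n]) (simp add: diff_divide_distrib)
    then have "D n = D (Suc n) / (if d n then q1 else q0)"
      using q unfolding D_def w_def by simp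
    also have "\<dots> \<le> D (Suc n) / q"
      using q1 q by (intro divide_left_mono) (auto simp: q_def D_def)
    finally show ?thesis .
  qed
  have "D 0 \<le> (M + (q1 - 1) * C) * (1 / q) ^ n" for n
  proof -
    have "D 0 \<le> D n * (1 / q) ^ n"
    proof (induction n)
      case (Suc n)
      have "D n * (1 / q) ^ n \<le> (D (Suc n) / q) * (1 / q) ^ n"
        using D_step[of n] q1 by (intro mult_right_mono) auto
      with Suc show ?case by simp
    qed simp
    also have "\<dots> \<le> (M + (q1 - 1) * C) * (1 / q) ^ n"
      using D_bdd q1 by (intro mult_right_mono) auto
    finally show ?thesis .
  qed
  moreover have "(\<lambda>n. (M + (q1 - 1) * C) * (1 / q) ^ n) \<longlonglongrightarrow> (M + (q1 - 1) * C) * 0"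
    using q1 by (intro tendsto_intros LIMSEQ_realpow_zero) auto
  ultimately have "D 0 \<le> (M + (q1 - 1) * C) * 0"
    by (intro LIMSEQ_le_const) auto
  then show ?thesis by (simp add: D_def)
qed

text \<open>Exchanging the two digits and the two bases reverses the unit interval. This symmetry
  reduces every statement on \<open>\<mu>\<close> to one on \<open>\<alpha>\<close>.\<close>

lemma nval_flip:
  assumes q: "1 < q0" "1 < q1"
  shows "nval q1 q0 (flip d) = 1 - nval q0 q1 d"
proof -
  obtain C where C: "\<And>e. dbe_value q0 q1 e \<le> C"
    using dbe_value_bounded[OF q] by blast
  have "1 - nval q0 q1 ((shift ^^ 0) d) = nval q1 q0 (flip d)"
  proof (rule nval_eqI[where x = "\<lambda>n. 1 - nval q0 q1 ((shift ^^ n) d)"])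
    fix n
    have "nval q0 q1 ((shift ^^ n) d) \<le> (q1 - 1) * C"
      unfolding nval_def using C q by (intro mult_left_mono) auto
    then show "\<bar>1 - nval q0 q1 ((shift ^^ n) d)\<bar> \<le> 1 + (q1 - 1) * C"
      using nval_nonneg[OF q, of "(shift ^^ n) d"] by linarith
    show "1 - nval q0 q1 ((shift ^^ n) d) =
        (if flip d n then 1 - (1 - (1 - nval q0 q1 ((shift ^^ Suc n) d))) / q0
         else (1 - nval q0 q1 ((shift ^^ Suc n) d)) / q1)"
      by (subst nval_rec[OF q]) (simp add: funpow_shift shift_def flip_def)
  qed (use q in auto)
  then show ?thesis by simp
qed

lemma nval_le_1:
  assumes "1 < q0" "1 < q1"
  shows "nval q0 q1 d \<le> 1"
  using nval_flip[OF assms, of d] nval_nonneg[of q1 q0 "flip d"] assms by simp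

lemma nval_lower_bound:
  assumes q: "1 < q0" "1 < q1" and "d k" "k \<le> N"
  shows "(1 - 1 / q1) / q0 ^ N \<le> nval q0 q1 d"
  using assms(3,4)
proof (induction N arbitrary: d k)
  case 0
  then have "d 0" by simp
  then show ?case
    using nval_rec[OF q, of d] nval_nonneg[OF q, of "shift d"] q by (simp add: diff_divide_distrib)
next
  case (Suc N)
  show ?case
  proof (cases "d 0")
    case True
    have "(1 - 1 / q1) / q0 ^ Suc N \<le> (1 - 1 / q1) / 1"
      using q one_le_power[of q0 "Suc N"] by (intro divide_left_mono) auto
    also have "\<dots> \<le> nval q0 q1 d"
      using True nval_rec[OF q, of d] nval_nonneg[OF q, of "shift d"] q
      by (simp add: diff_divide_distrib)
    finally show ?thesis .
  next
    case False
    then obtain j where j: "k = Suc j" using Suc.prems by (cases k) auto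
    have "(1 - 1 / q1) / q0 ^ N \<le> nval q0 q1 (shift d)"
      using Suc.IH[of "shift d" j] Suc.prems by (simp add: j shift_def)
    then have "(1 - 1 / q1) / q0 ^ N / q0 \<le> nval q0 q1 (shift d) / q0"
      using q by (intro divide_right_mono) auto
    then show ?thesis
      using False nval_rec[OF q, of d] by (simp add: mult.commute)
  qed
qed

lemma nval_pos:
  assumes "1 < q0" "1 < q1" "d \<noteq> (\<lambda>_. False)"
  shows "0 < nval q0 q1 d"
proof -
  obtain k where "d k" using assms(3) by auto
  then have "(1 - 1 / q1) / q0 ^ k \<le> nval q0 q1 d"
    using nval_lower_bound assms(1,2) by blast
  moreover have "0 < (1 - 1 / q1) / q0 ^ k" using assms by simp
  ultimately show ?thesis by linarith
qed

lemma nval_less_1: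
  assumes "1 < q0" "1 < q1" "d \<noteq> (\<lambda>_. True)"
  shows "nval q0 q1 d < 1"
proof -
  have "flip d \<noteq> (\<lambda>_. False)" using assms(3) by (auto simp: flip_def fun_eq_iff)
  then show ?thesis using nval_pos[of q1 q0 "flip d"] nval_flip[of q0 q1 d] assms by simp
qed

lemma nval_False: "nval q0 q1 (\<lambda>_. False) = 0"
  by (simp add: nval_def dbe_value_def)

lemma nval_True:
  assumes "1 < q0" "1 < q1" shows "nval q0 q1 (\<lambda>_. True) = 1"
  using nval_flip[of q1 q0 "\<lambda>_. False"] assms by (simp add: nval_False flip_def)

text \<open>On a common prefix the value is one affine contraction, so comparing two sequences
  amounts to comparing their tails behind the prefix.\<close>

lemma nval_diff_prefix:
  assumes q: "1 < q0" "1 < q1" and "\<And>i. i < k \<Longrightarrow> d i = e i"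
  shows "\<exists>c>0. c \<le> 1 \<and> nval q0 q1 d - nval q0 q1 e
    = c * (nval q0 q1 ((shift ^^ k) d) - nval q0 q1 ((shift ^^ k) e))"
  using assms(3)
proof (induction k arbitrary: d e)
  case 0
  show ?case by (intro exI[of _ 1]) simp
next
  case (Suc k)
  have "d 0 = e 0" using Suc.prems by simp
  define b where "b = (if d 0 then q1 else q0)"
  have b: "b > 1" using q by (simp add: b_def)
  have "shift d i = shift e i" if "i < k" for i using Suc.prems[of "Suc i"] that by (simp add: shift_def)
  from Suc.IH[of "shift d" "shift e", OF this] obtain c where c: "c > 0" "c \<le> 1"
    "nval q0 q1 (shift d) - nval q0 q1 (shift e) = c * (nval q0 q1 ((shift ^^ k) (shift d)) - nval q0 q1 ((shift ^^ k) (shift e)))"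
    by blast
  have "nval q0 q1 d - nval q0 q1 e = (nval q0 q1 (shift d) - nval q0 q1 (shift e)) / b"
    using nval_rec[OF q, of d] nval_rec[OF q, of e] \<open>d 0 = e 0\<close>
    by (auto simp: b_def diff_divide_distrib)
  then have "nval q0 q1 d - nval q0 q1 e
      = c / b * (nval q0 q1 ((shift ^^ Suc k) d) - nval q0 q1 ((shift ^^ Suc k) e))"
    by (simp add: c(3) funpow_Suc_right del: funpow.simps)
  moreover have "0 < c / b" "c / b \<le> 1" using c b by auto
  ultimately show ?case by blast
qed

section \<open>Quasi-greedy sequences\<close>

text \<open>The normalised value of \<open>arr\<close>. That of \<open>ell\<close> is 1 minus the threshold of the exchanged bases.\<close>

definition thr :: "real \<Rightarrow> real \<Rightarrow> real"
  where "thr q0 q1 = q0 * (q1 - 1) / q1"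

lemma dbe_arr_iff:
  assumes "1 < q0" "1 < q1"
  shows "d \<in> dbe q0 q1 (arr q0 q1) \<longleftrightarrow> nval q0 q1 d = thr q0 q1"
proof -
  have "thr q0 q1 = (q1 - 1) * arr q0 q1" by (simp add: thr_def arr_def)
  then show ?thesis using assms by (simp add: dbe_def nval_def)
qed

lemma dbe_ell_iff:
  assumes "1 < q0" "1 < q1"
  shows "d \<in> dbe q0 q1 (ell q0 q1) \<longleftrightarrow> nval q0 q1 d = 1 - thr q1 q0"
proof -
  have "1 - thr q1 q0 = (q1 - 1) * ell q0 q1"
    using assms by (simp add: thr_def ell_def field_simps)
  then show ?thesis using assms by (simp add: dbe_def nval_def)
qed

lemma dbe_ell_flip_iff:
  assumes "1 < q0" "1 < q1"
  shows "flip d \<in> dbe q0 q1 (ell q0 q1) \<longleftrightarrow> d \<in> dbe q1 q0 (arr q1 q0)"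
  using dbe_ell_iff[OF assms, of "flip d"] dbe_arr_iff[of q1 q0 d] nval_flip[of q1 q0 d] assms
  by auto

text \<open>The largest infinite expansion uses the digit 1 as soon as a positive remainder is left, that is,
  above the value \<open>1 - 1 / q1\<close> of \<open>1 0\<^sup>\<infinity>\<close>. Where it has a digit 0, the remainder is thus at most
  \<open>1 - 1 / q1\<close> before and at most \<open>q0 (1 - 1 / q1)\<close> behind it.\<close>

definition greedy :: "real \<Rightarrow> real \<Rightarrow> bseq \<Rightarrow> bool"
  where "greedy q0 q1 d \<longleftrightarrow> (\<forall>n. \<not> d n \<longrightarrow> nval q0 q1 ((shift ^^ Suc n) d) \<le> thr q0 q1)"

text \<open>At the first difference both remainders are compared with \<open>1 - 1 / q1\<close>, the value of
  \<open>1 0\<^sup>\<infinity>\<close>. The larger sequence lies above it by its next remainder divided by \<open>q1\<close>, and the smaller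
  one by the excess of its next remainder over the threshold, divided by \<open>q0\<close>.\<close>

lemma nval_diff_first:
  assumes q: "1 < q0" "1 < q1" and less: "d \<prec>\<^sub>l e"
  obtains k c where "\<not> d k" "e k" "0 < c" "c \<le> 1"
    "nval q0 q1 d - nval q0 q1 e
      = c * ((nval q0 q1 ((shift ^^ Suc k) d) - thr q0 q1) / q0 - nval q0 q1 ((shift ^^ Suc k) e) / q1)"
proof -
  obtain k where d: "\<not> d k" and e: "e k" and eq: "\<And>i. i < k \<Longrightarrow> d i = e i"
    using less unfolding lex_less_iff by blast
  have "nval q0 q1 ((shift ^^ k) d) = nval q0 q1 ((shift ^^ Suc k) d) / q0"
    "nval q0 q1 ((shift ^^ k) e) = 1 - (1 - nval q0 q1 ((shift ^^ Suc k) e)) / q1"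
    using nval_rec[OF q, of "(shift ^^ k) d"] nval_rec[OF q, of "(shift ^^ k) e"] d e
    by (simp_all add: funpow_shift shift_def)
  moreover have "x / q0 - (1 - (1 - y) / q1) = (x - thr q0 q1) / q0 - y / q1" for x y
    using q by (simp add: thr_def field_simps)
  moreover obtain c where c: "0 < c" "c \<le> 1" "nval q0 q1 d - nval q0 q1 e
      = c * (nval q0 q1 ((shift ^^ k) d) - nval q0 q1 ((shift ^^ k) e))"
    using nval_diff_prefix[OF q, of k d e] eq by blast
  ultimately show ?thesis
    by (intro that[OF d e c(1,2)]) simp
qed

text \<open>Order determines values: behind the first difference the greedy sequence has no excess over the
  threshold, and the infinite sequence has a positive remainder.\<close>

lemma greedy_less:
  assumes q: "1 < q0" "1 < q1" and d: "greedy q0 q1 d" and e: "\<not> finite_seq e"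
    and less: "d \<prec>\<^sub>l e"
  shows "nval q0 q1 d < nval q0 q1 e"
proof -
  obtain k c where k: "\<not> d k" "e k" and c: "0 < c" "nval q0 q1 d - nval q0 q1 e
      = c * ((nval q0 q1 ((shift ^^ Suc k) d) - thr q0 q1) / q0 - nval q0 q1 ((shift ^^ Suc k) e) / q1)"
    using nval_diff_first[OF q less] by blast
  have "nval q0 q1 ((shift ^^ Suc k) d) \<le> thr q0 q1"
    using d k(1) unfolding greedy_def by blast
  moreover have "0 < nval q0 q1 ((shift ^^ Suc k) e)"
    using infinite_seqD[of e k, OF e k(2)] by (rule nval_pos[OF q])
  ultimately have "(nval q0 q1 ((shift ^^ Suc k) d) - thr q0 q1) / q0 \<le> 0"
    "0 < nval q0 q1 ((shift ^^ Suc k) e) / q1"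
    using q by (auto intro: divide_nonpos_pos)
  then have "(nval q0 q1 ((shift ^^ Suc k) d) - thr q0 q1) / q0 - nval q0 q1 ((shift ^^ Suc k) e) / q1 < 0"
    by linarith
  then have "nval q0 q1 d - nval q0 q1 e < 0"
    unfolding c(2) by (rule mult_pos_neg[OF c(1)])
  then show ?thesis by simp
qed

text \<open>Here strictness comes from the smaller sequence: its remainder behind the first difference is
  strictly below the threshold, and remainders are never negative.\<close>

lemma strictly_greedy_less:
  assumes q: "1 < q0" "1 < q1"
    and d: "\<And>n. \<not> d n \<Longrightarrow> nval q0 q1 ((shift ^^ Suc n) d) < thr q0 q1"
    and less: "d \<prec>\<^sub>l e"
  shows "nval q0 q1 d < nval q0 q1 e"
proof -
  obtain k c where k: "\<not> d k" "e k" and c: "0 < c" "nval q0 q1 d - nval q0 q1 e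
      = c * ((nval q0 q1 ((shift ^^ Suc k) d) - thr q0 q1) / q0 - nval q0 q1 ((shift ^^ Suc k) e) / q1)"
    using nval_diff_first[OF q less] by blast
  have "(nval q0 q1 ((shift ^^ Suc k) d) - thr q0 q1) / q0 < 0"
    using d[OF k(1)] q by (intro divide_neg_pos) auto
  moreover have "0 \<le> nval q0 q1 ((shift ^^ Suc k) e) / q1"
    using nval_nonneg[OF q] q by simp
  ultimately have "(nval q0 q1 ((shift ^^ Suc k) d) - thr q0 q1) / q0 - nval q0 q1 ((shift ^^ Suc k) e) / q1 < 0"
    by linarith
  then have "nval q0 q1 d - nval q0 q1 e < 0"
    unfolding c(2) by (rule mult_pos_neg[OF c(1)])
  then show ?thesis by simp
qed

text \<open>Lexicographic domination by an expansion \<open>\<alpha>\<close> of the threshold bounds the value. An excess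
  over the threshold would have to show up at the first difference with \<open>\<alpha>\<close>, where it is passed
  on to a tail of the same family, enlarged at least by the factor \<open>q0 > 1\<close>; values are bounded, so there
  is no excess.\<close>

lemma nval_le_thr_if_dominated:
  assumes q: "1 < q0" "1 < q1" and \<alpha>: "nval q0 q1 \<alpha> = thr q0 q1"
    and le: "\<And>e. e \<in> X \<Longrightarrow> e \<preceq>\<^sub>l \<alpha>"
    and tail: "\<And>e n. e \<in> X \<Longrightarrow> \<not> e n \<Longrightarrow> (shift ^^ Suc n) e \<in> X"
    and "e \<in> X"
  shows "nval q0 q1 e \<le> thr q0 q1"
proof -
  have thr0: "0 \<le> thr q0 q1" using nval_nonneg[OF q, of \<alpha>] \<alpha> by simp
  have "\<forall>e\<in>X. nval q0 q1 e - thr q0 q1 \<le> (1 / q0) ^ j" for j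
  proof (induction j)
    case 0
    show ?case
    proof
      fix e show "nval q0 q1 e - thr q0 q1 \<le> (1 / q0) ^ 0"
        using nval_le_1[OF q, of e] thr0 by simp
    qed
  next
    case (Suc j)
    show ?case
    proof
      fix e assume e: "e \<in> X"
      have pos: "0 < (1 / q0) ^ Suc j" using q by simp
      show "nval q0 q1 e - thr q0 q1 \<le> (1 / q0) ^ Suc j"
      proof (cases "e = \<alpha>")
        case True
        then show ?thesis using \<alpha> pos by simp
      next
        case False
        then have "e \<prec>\<^sub>l \<alpha>" using le[OF e] by (simp add: lex_le_def)
        then obtain k c where k: "\<not> e k" and c: "0 < c" "c \<le> 1" and
          diff: "nval q0 q1 e - nval q0 q1 \<alpha> = c * ((nval q0 q1 ((shift ^^ Suc k) e) - thr q0 q1) / q0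
            - nval q0 q1 ((shift ^^ Suc k) \<alpha>) / q1)"
          using nval_diff_first[OF q] by metis
        define x where "x = nval q0 q1 ((shift ^^ Suc k) e) - thr q0 q1"
        define y where "y = nval q0 q1 ((shift ^^ Suc k) \<alpha>)"
        have "x \<le> (1 / q0) ^ j" using Suc tail[OF e k] unfolding x_def by blast
        then have "x / q0 \<le> (1 / q0) ^ Suc j" using q by (simp add: divide_right_mono)
        moreover have "0 \<le> y / q1" unfolding y_def using q nval_nonneg[OF q] by simp
        ultimately have "x / q0 - y / q1 \<le> (1 / q0) ^ Suc j" by linarith
        then have "c * (x / q0 - y / q1) \<le> c * (1 / q0) ^ Suc j"
          using c(1) by (intro mult_left_mono) auto
        also have "\<dots> \<le> 1 * (1 / q0) ^ Suc j"
          using c(2) pos by (intro mult_right_mono) auto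
        finally show ?thesis using diff unfolding x_def y_def \<alpha> by simp
      qed
    qed
  qed
  then have "nval q0 q1 e - thr q0 q1 \<le> (1 / q0) ^ j" for j using \<open>e \<in> X\<close> by blast
  moreover have "(\<lambda>j. (1 / q0) ^ j) \<longlonglongrightarrow> 0"
    using q by (intro LIMSEQ_realpow_zero) auto
  ultimately have "nval q0 q1 e - thr q0 q1 \<le> 0"
    by (intro LIMSEQ_le_const) auto
  then show ?thesis by simp
qed

text \<open>By the weak bound all members of the family are greedy, and then a strict lexicographic inequality
  becomes a strict inequality of values.\<close>

lemma nval_less_thr_if_strictly_dominated:
  assumes q: "1 < q0" "1 < q1" and \<alpha>: "nval q0 q1 \<alpha> = thr q0 q1" "\<not> finite_seq \<alpha>"
    and less: "\<And>e. e \<in> X \<Longrightarrow> e \<prec>\<^sub>l \<alpha>"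
    and tail: "\<And>e n. e \<in> X \<Longrightarrow> (shift ^^ Suc n) e \<in> X"
    and "e \<in> X"
  shows "nval q0 q1 e < thr q0 q1"
proof -
  have "nval q0 q1 e \<le> thr q0 q1" if "e \<in> X" for e
    using nval_le_thr_if_dominated[OF q \<alpha>(1), of X e] less tail that by (auto simp: lex_le_def)
  then have "greedy q0 q1 e"
    unfolding greedy_def using tail[OF \<open>e \<in> X\<close>] by blast
  then show ?thesis using greedy_less[OF q _ \<alpha>(2) less[OF \<open>e \<in> X\<close>]] \<alpha>(1) by simp
qed

lemma thr_le_1_iff:
  assumes "1 < q0" "1 < q1"
  shows "thr q0 q1 \<le> 1 \<longleftrightarrow> (q0 - 1) * (q1 - 1) \<le> 1"
  using assms by (simp add: thr_def field_simps)

lemma thr_less_1_iff: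
  assumes "1 < q0" "1 < q1"
  shows "thr q0 q1 < 1 \<longleftrightarrow> (q0 - 1) * (q1 - 1) < 1"
  using assms by (simp add: thr_def field_simps)

lemma thr_le_1_commute:
  assumes "1 < q0" "1 < q1"
  shows "thr q1 q0 \<le> 1 \<longleftrightarrow> thr q0 q1 \<le> 1"
  using assms by (simp add: thr_le_1_iff mult.commute)

lemma thr_less_1_commute:
  assumes "1 < q0" "1 < q1"
  shows "thr q1 q0 < 1 \<longleftrightarrow> thr q0 q1 < 1"
  using assms by (simp add: thr_less_1_iff mult.commute)

lemma thr_pos:
  assumes "1 < q0" "1 < q1"
  shows "0 < thr q0 q1"
  using assms by (simp add: thr_def)

text \<open>Subtract greedily, but only while a positive remainder is left. The remainders stay in \<open>(0, 1]\<close>: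
  a digit 0 multiplies a remainder of at most \<open>1 - 1 / q1\<close> by \<open>q0\<close>, which the threshold bounds. Positive
  remainders exclude a tail \<open>0\<^sup>\<infinity>\<close>.\<close>

lemma ex_greedy:
  assumes q: "1 < q0" "1 < q1" and thr: "thr q0 q1 \<le> 1" and x: "0 < x" "x \<le> 1"
  obtains d where "nval q0 q1 d = x" "\<not> finite_seq d" "greedy q0 q1 d"
proof -
  define T where "T y = (if 1 - 1 / q1 < y then 1 - q1 * (1 - y) else q0 * y)" for y
  define X where "X n = (T ^^ n) x" for n
  define d where "d n \<longleftrightarrow> 1 - 1 / q1 < X n" for n
  have X_Suc: "X (Suc n) = (if d n then 1 - q1 * (1 - X n) else q0 * X n)" for n
    by (simp add: X_def T_def d_def)
  have small: "q0 * y \<le> thr q0 q1" if "y \<le> 1 - 1 / q1" for y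
    using mult_left_mono[OF that, of q0] q by (simp add: thr_def field_simps)
  have large: "0 < 1 - q1 * (1 - y)" if "1 - 1 / q1 < y" for y
    using that q by (simp add: field_simps)
  have range: "0 < X n \<and> X n \<le> 1" for n
  proof (induction n)
    case 0
    show ?case using x by (simp add: X_def)
  next
    case (Suc n)
    show ?case
    proof (cases "d n")
      case True
      then show ?thesis using large[of "X n"] Suc q by (simp add: X_Suc d_def)
    next
      case False
      then have "q0 * X n \<le> 1" using small[of "X n"] thr by (simp add: d_def)
      then show ?thesis using Suc q False by (simp add: X_Suc)
    qed
  qed
  have val: "nval q0 q1 ((shift ^^ m) d) = X m" for m
  proof -
    have "X (m + 0) = nval q0 q1 ((shift ^^ m) d)"
    proof (rule nval_eqI[OF q, where x = "\<lambda>n. X (m + n)"])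
      fix n
      show "\<bar>X (m + n)\<bar> \<le> 1" using range[of "m + n"] by simp
      show "X (m + n) = (if (shift ^^ m) d n then 1 - (1 - X (m + Suc n)) / q1 else X (m + Suc n) / q0)"
        using q by (simp add: X_Suc funpow_shift)
    qed
    then show ?thesis by simp
  qed
  show ?thesis
  proof
    show "nval q0 q1 d = x" using val[of 0] by (simp add: X_def)
    show "\<not> finite_seq d"
    proof
      assume "finite_seq d"
      then obtain K where "\<And>k. k > K \<Longrightarrow> \<not> d k" unfolding finite_seq_def by blast
      then have "(shift ^^ Suc K) d = (\<lambda>_. False)" unfolding funpow_shift by auto
      then have "X (Suc K) = 0" using val[of "Suc K"] by (simp add: nval_False del: funpow.simps)
      then show False using range[of "Suc K"] by simp
    qed
    show "greedy q0 q1 d"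
      unfolding greedy_def val using small by (auto simp: X_Suc d_def)
  qed
qed

section \<open>The expansions \<open>\<alpha>\<close> and \<open>\<mu>\<close>\<close>

text \<open>An infinite expansion above a greedy one would have a larger value.\<close>

lemma alpha_seqI:
  assumes q: "1 < q0" "1 < q1"
    and d: "nval q0 q1 d = thr q0 q1" "\<not> finite_seq d" "greedy q0 q1 d"
  shows "alpha_seq q0 q1 = d"
proof -
  have max: "e \<preceq>\<^sub>l d" if "nval q0 q1 e = thr q0 q1" "\<not> finite_seq e" for e
    using greedy_less[OF q d(3) that(2)] that d(1) by (auto simp: lex_le_iff_not_less)
  show ?thesis
    unfolding alpha_seq_def dbe_arr_iff[OF q] Ball_def
  proof (rule the_equality)
    fix e assume e: "nval q0 q1 e = thr q0 q1 \<and> \<not> finite_seq e \<and>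
      (\<forall>x. nval q0 q1 x = thr q0 q1 \<longrightarrow> \<not> finite_seq x \<longrightarrow> x \<preceq>\<^sub>l e)"
    then have "d \<preceq>\<^sub>l e" "e \<preceq>\<^sub>l d" using d max by blast+
    then show "e = d" using less_fun_asym by (auto simp: lex_le_def)
  qed (use d max in blast)
qed

lemma alpha_seq_props:
  assumes q: "1 < q0" "1 < q1" and thr: "thr q0 q1 \<le> 1"
  shows "nval q0 q1 (alpha_seq q0 q1) = thr q0 q1" "\<not> finite_seq (alpha_seq q0 q1)"
    "greedy q0 q1 (alpha_seq q0 q1)"
proof -
  obtain d where d: "nval q0 q1 d = thr q0 q1" "\<not> finite_seq d" "greedy q0 q1 d"
    using ex_greedy[OF q thr thr_pos[OF q] thr] by blast
  then have "alpha_seq q0 q1 = d" by (rule alpha_seqI[OF q])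
  with d show "nval q0 q1 (alpha_seq q0 q1) = thr q0 q1" "\<not> finite_seq (alpha_seq q0 q1)"
    "greedy q0 q1 (alpha_seq q0 q1)" by simp_all
qed

text \<open>Negating digits maps the co-infinite expansions of \<open>ell q0 q1\<close> to the infinite expansions of
  \<open>arr q1 q0\<close> and reverses the order.\<close>

lemma mu_seq_eq_flip:
  assumes q: "1 < q0" "1 < q1" and thr: "thr q0 q1 \<le> 1"
  shows "mu_seq q0 q1 = flip (alpha_seq q1 q0)"
proof -
  let ?a = "alpha_seq q1 q0"
  have thr': "thr q1 q0 \<le> 1" using thr thr_le_1_commute[OF q] by simp
  note a = alpha_seq_props[OF q(2,1) thr']
  have mem: "e \<in> dbe q0 q1 (ell q0 q1) \<longleftrightarrow> nval q1 q0 (flip e) = thr q1 q0" for e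
    using dbe_ell_flip_iff[OF q, of "flip e"] dbe_arr_iff[OF q(2,1)] by simp
  have min: "flip ?a \<preceq>\<^sub>l e" if "nval q1 q0 (flip e) = thr q1 q0" "\<not> cofinite_seq e" for e
  proof -
    have "\<not> ?a \<prec>\<^sub>l flip e"
      using greedy_less[OF q(2,1) a(3), of "flip e"] that a(1) by (auto simp: finite_seq_flip)
    then have "flip e \<preceq>\<^sub>l ?a" by (simp add: lex_le_iff_not_less)
    then show ?thesis using lex_le_flip[of ?a "flip e"] by simp
  qed
  have coinf: "\<not> cofinite_seq (flip ?a)" using a(2) finite_seq_flip[of "flip ?a"] by simp
  show ?thesis
    unfolding mu_seq_def Ball_def mem
  proof (rule the_equality)
    fix e assume e: "nval q1 q0 (flip e) = thr q1 q0 \<and> \<not> cofinite_seq e \<and>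
      (\<forall>x. nval q1 q0 (flip x) = thr q1 q0 \<longrightarrow> \<not> cofinite_seq x \<longrightarrow> e \<preceq>\<^sub>l x)"
    then have "e \<preceq>\<^sub>l flip ?a" "flip ?a \<preceq>\<^sub>l e" using a coinf min by auto
    then show "e = flip ?a" using less_fun_asym by (auto simp: lex_le_def)
  qed (use a coinf min in auto)
qed

lemma alpha_seq_0:
  assumes q: "1 < q0" "1 < q1" and thr: "thr q0 q1 \<le> 1"
  shows "alpha_seq q0 q1 0"
proof (rule ccontr)
  let ?a = "alpha_seq q0 q1"
  assume 0: "\<not> ?a 0"
  note a = alpha_seq_props[OF q thr]
  have "nval q0 q1 (shift ?a) \<le> thr q0 q1" using a(3) 0 unfolding greedy_def by fastforce
  moreover have "nval q0 q1 (shift ?a) = q0 * thr q0 q1"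
    using nval_rec[OF q, of ?a] 0 a(1) q by simp
  ultimately show False using thr_pos[OF q] q by simp
qed

text \<open>Removing the leading digit 1 turns the threshold into an expression that is symmetric in the two
  bases.\<close>

lemma nval_eq_thr_iff:
  assumes q: "1 < q0" "1 < q1" and "d 0"
  shows "nval q0 q1 d = thr q0 q1 \<longleftrightarrow> nval q0 q1 (shift d) = (q0 - 1) * (q1 - 1)"
proof -
  have "nval q0 q1 d = 1 - (1 - nval q0 q1 (shift d)) / q1" using nval_rec[OF q] \<open>d 0\<close> by simp
  then show ?thesis using q by (auto simp: thr_def field_simps)
qed

text \<open>No tail exceeds the threshold in value: greediness gives this behind a digit 0, and a digit 1 never
  increases a remainder. For infinite sequences the order follows the values.\<close>

lemma alpha_seq_shift_le:
  assumes q: "1 < q0" "1 < q1" and thr: "thr q0 q1 \<le> 1"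
  shows "(shift ^^ n) (alpha_seq q0 q1) \<preceq>\<^sub>l alpha_seq q0 q1"
proof -
  let ?a = "alpha_seq q0 q1"
  note a = alpha_seq_props[OF q thr]
  have "nval q0 q1 ((shift ^^ n) ?a) \<le> thr q0 q1"
  proof (induction n)
    case 0
    show ?case using a by simp
  next
    case (Suc n)
    define y where "y = nval q0 q1 ((shift ^^ n) ?a)"
    define z where "z = nval q0 q1 ((shift ^^ Suc n) ?a)"
    have "z \<le> thr q0 q1"
    proof (cases "?a n")
      case False
      then show ?thesis using a(3) unfolding greedy_def z_def by blast
    next
      case True
      then have "y = 1 - (1 - z) / q1"
        unfolding y_def z_def using nval_rec[OF q, of "(shift ^^ n) ?a"]
        by (simp add: funpow_shift shift_def)
      moreover have "z \<le> 1" unfolding z_def by (rule nval_le_1[OF q])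
      then have "(1 - z) / q1 \<le> (1 - z) / 1" using q by (intro divide_left_mono) auto
      ultimately show ?thesis using Suc unfolding y_def by simp
    qed
    then show ?case unfolding z_def .
  qed
  then have "\<not> ?a \<prec>\<^sub>l (shift ^^ n) ?a"
    using greedy_less[OF q a(3), of "(shift ^^ n) ?a"] a finite_seq_shift_pow by fastforce
  then show ?thesis by (simp add: lex_le_iff_not_less)
qed

text \<open>Conversely, lexicographic maximality among its own tails makes an expansion of the threshold
  greedy.\<close>

lemma alpha_seq_lexI:
  assumes q: "1 < q0" "1 < q1" and d: "nval q0 q1 d = thr q0 q1" "\<not> finite_seq d"
    and le: "\<And>n. (shift ^^ n) d \<preceq>\<^sub>l d"
  shows "alpha_seq q0 q1 = d"
proof (rule alpha_seqI[OF q d])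
  have "nval q0 q1 e \<le> thr q0 q1" if "e \<in> range (\<lambda>n. (shift ^^ n) d)" for e
  proof (rule nval_le_thr_if_dominated[OF q d(1) _ _ that])
    fix e n assume "e \<in> range (\<lambda>n. (shift ^^ n) d)"
    then obtain m where "e = (shift ^^ m) d" by blast
    then have "(shift ^^ Suc n) e = (shift ^^ (Suc n + m)) d" by (simp only: funpow_add o_apply)
    then show "(shift ^^ Suc n) e \<in> range (\<lambda>n. (shift ^^ n) d)" by blast
  qed (use le in auto)
  then show "greedy q0 q1 d" unfolding greedy_def by blast
qed

section \<open>Unique expansions\<close>

text \<open>No remainder lies in the closed overlap of the two branches: for the digit 0 the overlap starts
  where the remainder behind it is the threshold, and for the digit 1 it ends where that remainder is
  the value of \<open>ell\<close>.\<close>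

definition univoque :: "real \<Rightarrow> real \<Rightarrow> bseq \<Rightarrow> bool"
  where "univoque q0 q1 d \<longleftrightarrow> (\<forall>n. if d n
    then 1 - thr q1 q0 < nval q0 q1 ((shift ^^ Suc n) d)
    else nval q0 q1 ((shift ^^ Suc n) d) < thr q0 q1)"

lemma univoque_flip:
  assumes "1 < q0" "1 < q1"
  shows "univoque q1 q0 (flip d) \<longleftrightarrow> univoque q0 q1 d"
proof -
  have "nval q1 q0 ((shift ^^ n) (flip d)) = 1 - nval q0 q1 ((shift ^^ n) d)" for n
    using nval_flip[OF assms] by (simp only: funpow_shift_flip)
  then have "(if flip d n then 1 - thr q0 q1 < nval q1 q0 ((shift ^^ Suc n) (flip d))
        else nval q1 q0 ((shift ^^ Suc n) (flip d)) < thr q1 q0)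
      \<longleftrightarrow> (if d n then 1 - thr q1 q0 < nval q0 q1 ((shift ^^ Suc n) d)
        else nval q0 q1 ((shift ^^ Suc n) d) < thr q0 q1)" for n
    by (auto simp: flip_def[of d] simp del: funpow.simps)
  then show ?thesis unfolding univoque_def by blast
qed

lemma univoque_less:
  assumes q: "1 < q0" "1 < q1" and "univoque q0 q1 d" "d \<prec>\<^sub>l e"
  shows "nval q0 q1 d < nval q0 q1 e"
proof (rule strictly_greedy_less[OF q _ \<open>d \<prec>\<^sub>l e\<close>])
  show "nval q0 q1 ((shift ^^ Suc n) d) < thr q0 q1" if "\<not> d n" for n
    using assms(3) that unfolding univoque_def by meson
qed

text \<open>An expansion above \<open>d\<close> has a larger value; one below \<open>d\<close> is treated by exchanging the
  digits.\<close>

lemma univoque_imp_unique: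
  assumes q: "1 < q0" "1 < q1" and d: "univoque q0 q1 d" and eq: "nval q0 q1 e = nval q0 q1 d"
  shows "e = d"
proof -
  have "\<not> d \<prec>\<^sub>l e" using univoque_less[OF q d, of e] eq by auto
  moreover have "\<not> flip d \<prec>\<^sub>l flip e"
    using univoque_less[OF q(2,1), of "flip d" "flip e"] univoque_flip[OF q] d eq
      nval_flip[OF q] by auto
  ultimately show ?thesis using lex_cases[of d e] by auto
qed

text \<open>A digit 0 whose remainder reaches the threshold lies in the overlap of the two branches, so it
  can be switched to a digit 1.\<close>

lemma ex_other_expansion:
  assumes q: "1 < q0" "1 < q1" and thr: "thr q0 q1 \<le> 1"
    and d: "\<not> d n" "thr q0 q1 \<le> nval q0 q1 ((shift ^^ Suc n) d)"
  shows "\<exists>e. e \<noteq> d \<and> nval q0 q1 e = nval q0 q1 d"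
proof -
  define x where "x = nval q0 q1 ((shift ^^ n) d)"
  define y where "y = 1 - q1 * (1 - x)"
  have x: "x = nval q0 q1 ((shift ^^ Suc n) d) / q0"
    using nval_rec[OF q, of "(shift ^^ n) d"] d(1) unfolding x_def by (simp add: funpow_shift shift_def)
  have "1 - 1 / q1 = thr q0 q1 / q0" using q by (simp add: thr_def field_simps)
  also have "\<dots> \<le> x" unfolding x using d(2) q by (intro divide_right_mono) auto
  finally have y0: "0 \<le> y" using q by (simp add: y_def field_simps)
  have "x \<le> 1" unfolding x_def by (rule nval_le_1[OF q])
  then have y1: "y \<le> 1" using q by (simp add: y_def)
  have "\<exists>d'. nval q0 q1 d' = y"
  proof (cases "y = 0")
    case True
    then show ?thesis using nval_False by metis
  next
    case False
    then show ?thesis using ex_greedy[OF q thr _ y1] y0 by (metis less_eq_real_def)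
  qed
  then obtain d' where d': "nval q0 q1 d' = y" by blast
  define e where "e i = (if i < n then d i else if i = n then True else d' (i - Suc n))" for i
  have "(shift ^^ n) e 0" "shift ((shift ^^ n) e) = d'"
    by (auto simp: funpow_shift shift_def e_def)
  then have "nval q0 q1 ((shift ^^ n) e) = x"
    using nval_rec[OF q, of "(shift ^^ n) e"] q by (simp add: d' y_def)
  moreover have "e i = d i" if "i < n" for i using that by (simp add: e_def)
  ultimately have "nval q0 q1 e = nval q0 q1 d"
    using nval_diff_prefix[OF q, of n e d] by (auto simp: x_def)
  moreover have "e n \<noteq> d n" using d(1) by (simp add: e_def)
  ultimately show ?thesis by metis
qed

lemma unique_imp_univoque:
  assumes q: "1 < q0" "1 < q1" and thr: "thr q0 q1 \<le> 1"
    and uniq: "\<And>e. nval q0 q1 e = nval q0 q1 d \<Longrightarrow> e = d"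
  shows "univoque q0 q1 d"
  unfolding univoque_def
proof (rule allI)
  fix n
  show "if d n then 1 - thr q1 q0 < nval q0 q1 ((shift ^^ Suc n) d)
    else nval q0 q1 ((shift ^^ Suc n) d) < thr q0 q1"
  proof (cases "d n")
    case False
    then show ?thesis using ex_other_expansion[OF q thr, of d n] uniq by (meson not_less)
  next
    case True
    have thr': "thr q1 q0 \<le> 1" using thr thr_le_1_commute[OF q] by simp
    have "\<not> thr q1 q0 \<le> nval q1 q0 ((shift ^^ Suc n) (flip d))"
    proof
      assume "thr q1 q0 \<le> nval q1 q0 ((shift ^^ Suc n) (flip d))"
      moreover have "\<not> flip d n" using True by (simp add: flip_def)
      ultimately obtain e where e: "e \<noteq> flip d" "nval q1 q0 e = nval q1 q0 (flip d)"
        using ex_other_expansion[OF q(2,1) thr'] by blast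
      have "nval q0 q1 (flip e) = nval q0 q1 d"
        using e(2) nval_flip[OF q, of d] nval_flip[OF q(2,1), of e] by simp
      then have "flip e = d" by (rule uniq)
      then show False using e(1) by auto
    qed
    then have "1 - thr q1 q0 < nval q0 q1 ((shift ^^ Suc n) d)"
      using nval_flip[OF q] by (simp only: funpow_shift_flip)
    then show ?thesis using True by simp
  qed
qed

lemma baseU_iff:
  assumes q: "1 < q0" "1 < q1" and thr: "thr q0 q1 \<le> 1"
  shows "(q0, q1) \<in> baseU \<longleftrightarrow> univoque q0 q1 (alpha_seq q0 q1) \<and> univoque q0 q1 (mu_seq q0 q1)"
proof -
  have ex1: "(\<exists>!e. nval q0 q1 e = nval q0 q1 d) \<longleftrightarrow> univoque q0 q1 d" for d
    using univoque_imp_unique[OF q, of d] unique_imp_univoque[OF q thr, of d] by metis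
  have "nval q0 q1 (alpha_seq q0 q1) = thr q0 q1"
    using alpha_seq_props[OF q thr] by simp
  moreover have "nval q0 q1 (mu_seq q0 q1) = 1 - thr q1 q0"
    using alpha_seq_props(1)[OF q(2,1)] thr thr_le_1_commute[OF q] nval_flip[OF q(2,1)]
    by (simp add: mu_seq_eq_flip[OF q thr])
  moreover have "q0 + q1 \<ge> q0 * q1"
    using thr thr_le_1_iff[OF q] by (simp add: algebra_simps)
  ultimately show ?thesis
    using q ex1[of "alpha_seq q0 q1"] ex1[of "mu_seq q0 q1"]
    by (auto simp: baseU_def dbe_arr_iff[OF q] dbe_ell_iff[OF q])
qed

text \<open>Univoqueness bounds each remainder only on the side where its last digit could be exchanged. On the
  other side the bound is inherited, since a digit 0 does not decrease a remainder and a digit 1 does not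
  increase it. The first remainder has to be treated separately; there, \<open>thr q0 q1 < 1\<close> makes the
  decrease strict.\<close>

lemma univoque_alpha_tails:
  assumes q: "1 < q0" "1 < q1" and thr: "thr q0 q1 < 1"
    and a: "univoque q0 q1 a" "nval q0 q1 a = thr q0 q1" "a 0" and "1 \<le> n"
  shows "1 - thr q1 q0 < nval q0 q1 ((shift ^^ n) a)" "nval q0 q1 ((shift ^^ n) a) < thr q0 q1"
proof -
  define x where "x n = nval q0 q1 ((shift ^^ n) a)" for n
  have x_step: "x n = (if a n then 1 - (1 - x (Suc n)) / q1 else x (Suc n) / q0)" for n
    unfolding x_def using nval_rec[OF q, of "(shift ^^ n) a"] by (simp add: funpow_shift shift_def)
  have x01: "0 \<le> x n" "x n \<le> 1" for n
    unfolding x_def by (rule nval_nonneg[OF q] nval_le_1[OF q])+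
  have digit1: "x (Suc n) \<le> x n" if "a n" for n
  proof -
    have "(1 - x (Suc n)) / q1 \<le> (1 - x (Suc n)) / 1"
      using q x01[of "Suc n"] by (intro divide_left_mono) auto
    then show ?thesis using x_step[of n] that by simp
  qed
  have digit0: "x n \<le> x (Suc n)" if "\<not> a n" for n
  proof -
    have "x (Suc n) / q0 \<le> x (Suc n) / 1"
      using q x01[of "Suc n"] by (intro divide_left_mono) auto
    then show ?thesis using x_step[of n] that by simp
  qed
  have u: "if a n then 1 - thr q1 q0 < x (Suc n) else x (Suc n) < thr q0 q1" for n
    using a(1) unfolding univoque_def x_def by blast
  have "1 - thr q1 q0 < x n \<and> x n < thr q0 q1"
    using \<open>1 \<le> n\<close>
  proof (induction n rule: nat_induct_at_least)
    case base
    have "x 0 = thr q0 q1" using a(2) by (simp add: x_def)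
    then have "1 - x 1 = q1 * (1 - thr q0 q1)"
      using x_step[of 0] a(3) q by (simp add: field_simps)
    moreover have "1 * (1 - thr q0 q1) < q1 * (1 - thr q0 q1)"
      using q thr by (intro mult_strict_right_mono) auto
    ultimately show ?case using u[of 0] a(3) by simp
  next
    case (Suc n)
    then show ?case using u[of n] digit0[of n] digit1[of n] by (cases "a n") auto
  qed
  then show "1 - thr q1 q0 < nval q0 q1 ((shift ^^ n) a)" "nval q0 q1 ((shift ^^ n) a) < thr q0 q1"
    by (simp_all add: x_def)
qed

lemma alpha_in_mu_tail_bounds:
  assumes q: "1 < q0" "1 < q1" and thr: "thr q0 q1 < 1"
    and a: "univoque q0 q1 (alpha_seq q0 q1)" and m: "univoque q0 q1 (mu_seq q0 q1)"
    and n: "1 \<le> n" and d: "d \<in> {alpha_seq q0 q1, mu_seq q0 q1}"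
  shows "1 - thr q1 q0 < nval q0 q1 ((shift ^^ n) d)" "nval q0 q1 ((shift ^^ n) d) < thr q0 q1"
proof -
  have thr1: "thr q0 q1 \<le> 1" using thr by simp
  have thr': "thr q1 q0 < 1" "thr q1 q0 \<le> 1" using thr thr_less_1_commute[OF q] by simp_all
  note mu = mu_seq_eq_flip[OF q thr1]
  have "1 - thr q1 q0 < nval q0 q1 ((shift ^^ n) (alpha_seq q0 q1)) \<and>
    nval q0 q1 ((shift ^^ n) (alpha_seq q0 q1)) < thr q0 q1"
    using univoque_alpha_tails[OF q thr a, of n] alpha_seq_0[OF q thr1] n
      alpha_seq_props[OF q thr1] by simp
  moreover have "1 - thr q1 q0 < nval q0 q1 ((shift ^^ n) (mu_seq q0 q1)) \<and>
    nval q0 q1 ((shift ^^ n) (mu_seq q0 q1)) < thr q0 q1"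
  proof -
    have "univoque q1 q0 (alpha_seq q1 q0)"
      using m univoque_flip[OF q(2,1)] by (simp add: mu)
    then have "1 - thr q0 q1 < nval q1 q0 ((shift ^^ n) (alpha_seq q1 q0))"
      "nval q1 q0 ((shift ^^ n) (alpha_seq q1 q0)) < thr q1 q0"
      using univoque_alpha_tails[OF q(2,1) thr'(1), of "alpha_seq q1 q0" n] alpha_seq_0[OF q(2,1) thr'(2)] n
        alpha_seq_props[OF q(2,1) thr'(2)] by simp_all
    then show ?thesis
      unfolding mu funpow_shift_flip nval_flip[OF q(2,1)] by linarith
  qed
  ultimately show "1 - thr q1 q0 < nval q0 q1 ((shift ^^ n) d)"
    "nval q0 q1 ((shift ^^ n) d) < thr q0 q1"
    using d by auto
qed

text \<open>From values to sequences: \<open>\<alpha>\<close> and the tails are univoque, so the order of values determines the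
  lexicographic order. From sequences to values: the proper tails of \<open>\<mu>\<close> and \<open>\<alpha>\<close> form one family
  that is strictly dominated by \<open>\<alpha>\<close>, and, after exchanging digits and bases, also by the negation of
  \<open>\<mu>\<close>.\<close>

lemma seqU_iff_univoque:
  assumes q: "1 < q0" "1 < q1" and thr: "thr q0 q1 < 1"
  shows "(mu_seq q0 q1, alpha_seq q0 q1) \<in> seqU
    \<longleftrightarrow> univoque q0 q1 (alpha_seq q0 q1) \<and> univoque q0 q1 (mu_seq q0 q1)"
    (is "(?m, ?a) \<in> seqU \<longleftrightarrow> ?U")
proof -
  have thr1: "thr q0 q1 \<le> 1" using thr by simp
  have thr': "thr q1 q0 < 1" "thr q1 q0 \<le> 1" using thr thr_less_1_commute[OF q] by simp_all
  note mu = mu_seq_eq_flip[OF q thr1]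
  note a = alpha_seq_props[OF q thr1] and a' = alpha_seq_props[OF q(2,1) thr'(2)]
  have val_m: "nval q0 q1 ?m = 1 - thr q1 q0" using a'(1) nval_flip[OF q(2,1)] by (simp add: mu)
  have 0: "?a 0" "\<not> ?m 0"
    using alpha_seq_0[OF q thr1] alpha_seq_0[OF q(2,1) thr'(2)] by (simp_all add: mu flip_def)
  show ?thesis
  proof
    assume U: ?U
    have "?m \<prec>\<^sub>l (shift ^^ n) d \<and> (shift ^^ n) d \<prec>\<^sub>l ?a" if "1 \<le> n" "d \<in> {?a, ?m}" for n d
    proof -
      note b = alpha_in_mu_tail_bounds[OF q thr conjunct1[OF U] conjunct2[OF U] that]
      have ud: "univoque q0 q1 d" using U that by auto
      have t: "univoque q0 q1 ((shift ^^ n) d)"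
        unfolding univoque_def
      proof
        fix k
        have "(shift ^^ Suc k) ((shift ^^ n) d) = (shift ^^ Suc (n + k)) d"
          by (simp add: funpow_shift add_ac del: funpow.simps)
        moreover have "(shift ^^ n) d k = d (n + k)" by (simp add: funpow_shift)
        ultimately show "if (shift ^^ n) d k then 1 - thr q1 q0 < nval q0 q1 ((shift ^^ Suc k) ((shift ^^ n) d))
          else nval q0 q1 ((shift ^^ Suc k) ((shift ^^ n) d)) < thr q0 q1"
          using ud unfolding univoque_def by metis
      qed
      have "\<not> ?a \<prec>\<^sub>l (shift ^^ n) d" using univoque_less[OF q conjunct1[OF U]] b a(1) by fastforce
      moreover have "\<not> (shift ^^ n) d \<prec>\<^sub>l ?m" using univoque_less[OF q t] b val_m by fastforce
      moreover have "(shift ^^ n) d \<noteq> ?a" "(shift ^^ n) d \<noteq> ?m" using a(1) val_m b by auto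
      ultimately show ?thesis using lex_cases by metis
    qed
    then show "(?m, ?a) \<in> seqU" using 0 by (auto simp: seqU_def Sigma0_def Sigma1_def)
  next
    assume S: "(?m, ?a) \<in> seqU"
    define X where "X = {(shift ^^ n) d | n d. 1 \<le> n \<and> d \<in> {?a, ?m}}"
    have X: "?m \<prec>\<^sub>l e" "e \<prec>\<^sub>l ?a" if "e \<in> X" for e
      using that S unfolding X_def seqU_def by auto
    have X_tail: "(shift ^^ Suc n) e \<in> X" if e: "e \<in> X" for e n
    proof -
      obtain k d where k: "e = (shift ^^ k) d" "1 \<le> k" "d \<in> {?a, ?m}"
        using e unfolding X_def by blast
      have "(shift ^^ Suc n) e = (shift ^^ (Suc n + k)) d"
        unfolding k(1) by (simp only: funpow_add o_apply)
      moreover have "1 \<le> Suc n + k" by simp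
      ultimately show ?thesis unfolding X_def using k(3) by blast
    qed
    have up: "nval q0 q1 e < thr q0 q1" if "e \<in> X" for e
      by (rule nval_less_thr_if_strictly_dominated[OF q a(1,2) X(2) X_tail that])
    have "nval q1 q0 e < thr q1 q0" if "e \<in> flip ` X" for e
    proof (rule nval_less_thr_if_strictly_dominated[OF q(2,1) a'(1,2) _ _ that])
      show "e \<prec>\<^sub>l alpha_seq q1 q0" if e: "e \<in> flip ` X" for e
      proof -
        obtain x where x: "x \<in> X" "e = flip x" using e by blast
        have "flip x \<prec>\<^sub>l flip (flip (alpha_seq q1 q0))"
          using X(1)[OF x(1)] unfolding mu lex_less_flip .
        then show ?thesis using x(2) by simp
      qed
      show "(shift ^^ Suc n) e \<in> flip ` X" if "e \<in> flip ` X" for e n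
        using that X_tail by (auto simp: funpow_shift_flip simp del: funpow.simps)
    qed
    then have "1 - thr q1 q0 < nval q0 q1 e" if "e \<in> X" for e
      using nval_flip[OF q, of e] that by fastforce
    moreover have "(shift ^^ Suc n) d \<in> X" if "d \<in> {?a, ?m}" for n d
    proof -
      have "1 \<le> Suc n" by simp
      then show ?thesis unfolding X_def using that by blast
    qed
    ultimately have "univoque q0 q1 d" if "d \<in> {?a, ?m}" for d
      using up that unfolding univoque_def by presburger
    then show ?U by blast
  qed
qed

section \<open>The equations for the bases\<close>

text \<open>Here \<open>a\<close> stands for \<open>\<alpha>\<close> without its leading 1 and \<open>b\<close> for the negation of \<open>\<mu>\<close> without its
  leading 0; both equations are instances of \<open>nval_eq_thr_iff\<close>.\<close>

definition solves :: "bseq \<Rightarrow> bseq \<Rightarrow> real \<Rightarrow> real \<Rightarrow> bool"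
  where "solves a b q0 q1 \<longleftrightarrow> 1 < q0 \<and> 1 < q1 \<and>
    nval q0 q1 a = (q0 - 1) * (q1 - 1) \<and> nval q1 q0 b = (q0 - 1) * (q1 - 1)"

lemma baseB_iff: "(q0, q1) \<in> baseB \<longleftrightarrow> 1 < q0 \<and> 1 < q1 \<and> thr q0 q1 < 1"
  using thr_less_1_iff[of q0 q1] by (auto simp: baseB_def algebra_simps)

lemma solves_Phi:
  assumes "(q0, q1) \<in> baseB"
  shows "solves (shift (snd (Phi (q0, q1)))) (flip (shift (fst (Phi (q0, q1))))) q0 q1"
proof -
  have q: "1 < q0" "1 < q1" and thr: "thr q0 q1 \<le> 1"
    using assms unfolding baseB_iff by auto
  have thr': "thr q1 q0 \<le> 1" using thr thr_le_1_commute[OF q] by simp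
  have "nval q0 q1 (shift (alpha_seq q0 q1)) = (q0 - 1) * (q1 - 1)"
    using nval_eq_thr_iff[OF q, of "alpha_seq q0 q1"] alpha_seq_0[OF q thr] alpha_seq_props[OF q thr] by simp
  moreover have "nval q1 q0 (shift (alpha_seq q1 q0)) = (q1 - 1) * (q0 - 1)"
    using nval_eq_thr_iff[OF q(2,1), of "alpha_seq q1 q0"] alpha_seq_0[OF q(2,1) thr'] alpha_seq_props[OF q(2,1) thr'] by simp
  ultimately show ?thesis
    using q by (simp add: solves_def Phi_def mu_seq_eq_flip[OF q thr] shift_flip[symmetric] mult.commute)
qed

lemma seqB_iff: "(\<mu>, \<alpha>) \<in> seqB \<longleftrightarrow> \<not> \<mu> 0 \<and> \<alpha> 0 \<and>
    \<mu> \<noteq> (\<lambda>_. False) \<and> \<alpha> \<noteq> (\<lambda>_. True) \<and> \<not> cofinite_seq \<mu> \<and> \<not> finite_seq \<alpha> \<and>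
    (\<forall>n. \<mu> \<preceq>\<^sub>l (shift ^^ n) \<mu>) \<and> (\<forall>n. (shift ^^ n) \<alpha> \<preceq>\<^sub>l \<alpha>)"
  by (auto simp: seqB_def seqC_def Sigma0_def Sigma1_def cofinite_seq_def finite_seq_def)

lemma Phi_in_seqB:
  assumes "(q0, q1) \<in> baseB"
  shows "Phi (q0, q1) \<in> seqB"
proof -
  have q: "1 < q0" "1 < q1" and thr: "thr q0 q1 \<le> 1" "thr q0 q1 < 1"
    using assms unfolding baseB_iff by auto
  have thr': "thr q1 q0 \<le> 1" "thr q1 q0 < 1" using thr thr_less_1_commute[OF q] by auto
  have "\<mu> \<preceq>\<^sub>l (shift ^^ n) \<mu>" if "\<mu> = flip (alpha_seq q1 q0)" for n \<mu>
    unfolding that using alpha_seq_shift_le[OF q(2,1) thr'(1)] by (simp add: funpow_shift_flip)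
  moreover have "alpha_seq q0 q1 \<noteq> (\<lambda>_. True)"
    using alpha_seq_props(1)[OF q thr(1)] nval_True[OF q] thr(2) by auto
  moreover have "alpha_seq q1 q0 \<noteq> (\<lambda>_. True)"
    using alpha_seq_props(1)[OF q(2,1) thr'(1)] nval_True[OF q(2,1)] thr'(2) by auto
  then have "flip (alpha_seq q1 q0) \<noteq> (\<lambda>_. False)" by (auto simp: flip_def fun_eq_iff)
  moreover have "\<not> cofinite_seq (flip (alpha_seq q1 q0))"
    using alpha_seq_props(2)[OF q(2,1) thr'(1)] finite_seq_flip[of "flip (alpha_seq q1 q0)"] by simp
  ultimately show ?thesis
    using alpha_seq_shift_le[OF q thr(1)] alpha_seq_props(2)[OF q thr(1)] alpha_seq_0[OF q thr(1)]
      alpha_seq_0[OF q(2,1) thr'(1)]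
    unfolding Phi_def split seqB_iff mu_seq_eq_flip[OF q thr(1)] by (auto simp: flip_def)
qed

text \<open>For sequences of \<open>seqB\<close> the equations already identify them as \<open>\<mu>\<close> and \<open>\<alpha>\<close>, because the
  lexicographic conditions make them quasi-lazy and quasi-greedy. As \<open>\<alpha>\<close> is not \<open>1\<^sup>\<infinity>\<close>, the common
  value \<open>(q0 - 1) (q1 - 1)\<close> is below 1.\<close>

lemma Phi_eqI:
  assumes S: "(\<mu>, \<alpha>) \<in> seqB" and sol: "solves (shift \<alpha>) (flip (shift \<mu>)) q0 q1"
  shows "(q0, q1) \<in> baseB" "Phi (q0, q1) = (\<mu>, \<alpha>)"
proof -
  note S = S[unfolded seqB_iff]
  have q: "1 < q0" "1 < q1" using sol by (auto simp: solves_def)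
  have "shift \<alpha> \<noteq> (\<lambda>_. True)"
  proof
    assume "shift \<alpha> = (\<lambda>_. True)"
    then have "\<alpha> n" for n using S by (cases n) (auto simp: shift_def fun_eq_iff)
    then show False using S by blast
  qed
  then have "(q0 - 1) * (q1 - 1) < 1" using nval_less_1[OF q] sol by (metis solves_def)
  then have thr: "thr q0 q1 < 1" using thr_less_1_iff[OF q] by simp
  then show B: "(q0, q1) \<in> baseB" using q by (simp add: baseB_iff)
  have "nval q0 q1 \<alpha> = thr q0 q1"
    using sol S nval_eq_thr_iff[OF q, of \<alpha>] by (simp add: solves_def)
  then have "alpha_seq q0 q1 = \<alpha>" using S by (intro alpha_seq_lexI[OF q]) auto
  moreover have "alpha_seq q1 q0 = flip \<mu>"
  proof (rule alpha_seq_lexI[OF q(2,1)])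
    have "flip \<mu> 0" using S by (simp add: flip_def)
    then show "nval q1 q0 (flip \<mu>) = thr q1 q0"
      using sol nval_eq_thr_iff[OF q(2,1), of "flip \<mu>"] by (simp add: solves_def shift_flip mult.commute)
    show "\<not> finite_seq (flip \<mu>)" using S by (simp add: finite_seq_flip)
    show "(shift ^^ n) (flip \<mu>) \<preceq>\<^sub>l flip \<mu>" for n using S by (simp add: funpow_shift_flip)
  qed
  ultimately show "Phi (q0, q1) = (\<mu>, \<alpha>)" using thr by (simp add: Phi_def mu_seq_eq_flip[OF q])
qed

text \<open>Enlarging \<open>q1\<close> pushes the branch of digit 1 towards 1, and lowering \<open>q0\<close> pulls the branch
  of digit 0 away from 0.\<close>

lemma nval_mono:
  assumes p: "1 < p0" "p0 \<le> q0" and q: "1 < q1" "q1 \<le> p1"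
  shows "nval q0 q1 d \<le> nval p0 p1 d"
proof -
  define m where "m = min q0 q1"
  have m: "1 < m" "m \<le> q0" "m \<le> q1" using assms by (auto simp: m_def)
  have bq: "1 < q0" "1 < q1" and bp: "1 < p0" "1 < p1" using assms by auto
  have "nval q0 q1 d \<le> nval p0 p1 d + (1 / m) ^ j" for j
  proof (induction j arbitrary: d)
    case 0
    show ?case using nval_le_1[OF bq, of d] nval_nonneg[OF bp, of d] by simp
  next
    case (Suc j)
    define x where "x = nval q0 q1 (shift d)"
    define y where "y = nval p0 p1 (shift d)"
    define t where "t = (1 / m) ^ j"
    have t: "0 \<le> t" "x \<le> y + t" using Suc.IH[of "shift d"] m by (simp_all add: x_def y_def t_def)
    have y: "0 \<le> y" "y \<le> 1" unfolding y_def by (rule nval_nonneg[OF bp] nval_le_1[OF bp])+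
    have t_div: "t / q0 \<le> t / m" "t / q1 \<le> t / m" using t m by (auto intro: divide_left_mono)
    have "nval q0 q1 d \<le> nval p0 p1 d + t / m"
    proof (cases "d 0")
      case True
      have "(1 - y) / p1 \<le> (1 - y) / q1" using y q by (intro divide_left_mono) auto
      moreover have "(1 - y - t) / q1 \<le> (1 - x) / q1" using t bq by (intro divide_right_mono) auto
      ultimately have "1 - (1 - x) / q1 \<le> 1 - (1 - y) / p1 + t / q1"
        by (simp add: diff_divide_distrib)
      then show ?thesis
        using t_div True nval_rec[OF bq, of d] nval_rec[OF bp, of d] by (simp add: x_def y_def)
    next
      case False
      have "y / q0 \<le> y / p0" using y p by (intro divide_left_mono) auto
      moreover have "x / q0 \<le> (y + t) / q0" using t bq by (intro divide_right_mono) auto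
      ultimately have "x / q0 \<le> y / p0 + t / q0" by (simp add: add_divide_distrib)
      then show ?thesis
        using t_div False nval_rec[OF bq, of d] nval_rec[OF bp, of d] by (simp add: x_def y_def)
    qed
    then show ?case by (simp add: t_def)
  qed
  moreover have "(\<lambda>j. nval p0 p1 d + (1 / m) ^ j) \<longlonglongrightarrow> nval p0 p1 d + 0"
    using m by (intro tendsto_intros LIMSEQ_realpow_zero) auto
  ultimately show ?thesis by (intro LIMSEQ_le_const) auto
qed

lemma nval_mono_strict:
  assumes p: "1 < p0" "p0 < q0" and q: "1 < q1" "q1 < p1"
    and d: "d \<noteq> (\<lambda>_. False)" "d \<noteq> (\<lambda>_. True)"
  shows "nval q0 q1 d < nval p0 p1 d"
proof -
  have bq: "1 < q0" "1 < q1" and bp: "1 < p0" "1 < p1" using assms by auto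
  have le: "nval q0 q1 (shift d) \<le> nval p0 p1 (shift d)" using nval_mono assms by simp
  show ?thesis
  proof (cases "d 0")
    case False
    have "shift d \<noteq> (\<lambda>_. False)"
    proof
      assume "shift d = (\<lambda>_. False)"
      then have "\<not> d n" for n using False by (cases n) (auto simp: shift_def fun_eq_iff)
      then show False using d by blast
    qed
    then have pos: "0 < nval p0 p1 (shift d)" using nval_pos[OF bp] by blast
    have "nval q0 q1 (shift d) / q0 \<le> nval p0 p1 (shift d) / q0"
      using le bq by (intro divide_right_mono) auto
    also have "\<dots> < nval p0 p1 (shift d) / p0"
      using pos p by (intro divide_strict_left_mono) auto
    finally show ?thesis using False nval_rec[OF bq, of d] nval_rec[OF bp, of d] by simp
  next
    case True
    have "shift d \<noteq> (\<lambda>_. True)"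
    proof
      assume "shift d = (\<lambda>_. True)"
      then have "d n" for n using True by (cases n) (auto simp: shift_def fun_eq_iff)
      then show False using d by blast
    qed
    then have pos: "0 < 1 - nval p0 p1 (shift d)" using nval_less_1[OF bp] by simp
    have "(1 - nval p0 p1 (shift d)) / p1 < (1 - nval p0 p1 (shift d)) / q1"
      using pos q by (intro divide_strict_left_mono) auto
    also have "\<dots> \<le> (1 - nval q0 q1 (shift d)) / q1"
      using le bq by (intro divide_right_mono) auto
    finally show ?thesis using True nval_rec[OF bq, of d] nval_rec[OF bp, of d] by simp
  qed
qed

lemma dbe_value_antimono:
  assumes q: "1 < q0" "1 < q1" and le: "q0 \<le> p0" "q1 \<le> p1"
  shows "dbe_value p0 p1 d \<le> dbe_value q0 q1 d"
  unfolding dbe_value_def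
proof (rule suminf_le)
  fix i
  have "(\<Prod>j\<le>i. if d j then q1 else q0) \<le> (\<Prod>j\<le>i. if d j then p1 else p0)"
    using assms by (intro prod_mono) auto
  moreover have "0 < (\<Prod>j\<le>i. if d j then q1 else q0)" using q by (intro prod_pos) auto
  ultimately show "of_bool (d i) / (\<Prod>j\<le>i. if d j then p1 else p0)
      \<le> of_bool (d i) / (\<Prod>j\<le>i. if d j then q1 else q0)"
    by (intro divide_left_mono) auto
qed (use assms in \<open>auto intro!: dbe_summable\<close>)

lemma solves_value:
  assumes "solves a b q0 q1"
  shows "dbe_value q0 q1 a = q0 - 1" "dbe_value q1 q0 b = q1 - 1"
  using assms by (auto simp: solves_def nval_def mult.commute)

text \<open>The equations fix the unnormalised values of \<open>a\<close> and \<open>b\<close> as \<open>q0 - 1\<close> and \<open>q1 - 1\<close>. Those values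
  do not increase with either base, so of two distinct solutions one has the larger \<open>q0\<close> and the other the
  larger \<open>q1\<close>. But then the normalised values of \<open>a\<close> and \<open>b\<close>, which are equal in each solution,
  change in opposite directions.\<close>

lemma solves_unique:
  assumes q: "solves a b q0 q1" and p: "solves a b p0 p1"
    and a: "a \<noteq> (\<lambda>_. False)" "a \<noteq> (\<lambda>_. True)"
  shows "p0 = q0 \<and> p1 = q1"
proof -
  have same: "p0 = q0 \<and> p1 = q1" if "solves a b q0 q1" "solves a b p0 p1" "q0 \<le> p0" "q1 \<le> p1"
    for q0 q1 p0 p1
  proof -
    have "1 < q0" "1 < q1" using that by (auto simp: solves_def)
    then show ?thesis
      using dbe_value_antimono[of q0 q1 p0 p1 a] dbe_value_antimono[of q1 q0 p1 p0 b]
        solves_value[OF that(1)] solves_value[OF that(2)] that by simp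
  qed
  have opposite: False if "solves a b q0 q1" "solves a b p0 p1" "p0 < q0" "q1 < p1"
    for q0 q1 p0 p1
  proof -
    have "1 < q0" "1 < q1" "1 < p0" "1 < p1" using that by (auto simp: solves_def)
    then have "nval q0 q1 a < nval p0 p1 a" "nval p1 p0 b \<le> nval q1 q0 b"
      using nval_mono_strict[of p0 q0 q1 p1 a] nval_mono[of q1 p1 p0 q0 b] that a by auto
    then show False using that by (simp add: solves_def)
  qed
  show ?thesis
    using same[OF q p] same[OF p q] opposite[OF q p] opposite[OF p q]
    by (smt (verit) less_eq_real_def linorder_not_less)
qed

section \<open>Existence of the bases\<close>

text \<open>Each term of the series depends on a finite prefix only, and near \<open>(q0, q1)\<close> all series have a
  common geometric majorant, so limit and sum can be interchanged.\<close>

lemma nval_tendsto: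
  assumes x: "x \<longlonglongrightarrow> q0" and y: "y \<longlonglongrightarrow> q1" and q: "1 < q0" "1 < q1"
    and d: "\<And>i. \<forall>\<^sub>F n in sequentially. d n i = e i"
  shows "(\<lambda>n. nval (x n) (y n) (d n)) \<longlonglongrightarrow> nval q0 q1 e"
proof -
  define c where "c = (1 + min q0 q1) / 2"
  have c: "1 < c" "c < q0" "c < q1" using q by (auto simp: c_def)
  have ev_x: "\<forall>\<^sub>F n in sequentially. c < x n" and ev_y: "\<forall>\<^sub>F n in sequentially. c < y n"
    using order_tendstoD(1)[OF x c(2)] order_tendstoD(1)[OF y c(3)] by auto
  define g where "g k n = (of_bool (d n k) / (\<Prod>j\<le>k. if d n j then y n else x n) :: real)" for k n
  have "(g k \<longlongrightarrow> of_bool (e k) / (\<Prod>j\<le>k. if e j then q1 else q0)) sequentially" for k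
  proof (rule Lim_transform_eventually)
    have "(\<lambda>n. if e j then y n else x n) \<longlonglongrightarrow> (if e j then q1 else q0)" for j
      using x y by simp
    moreover have "(\<Prod>j\<le>k. if e j then q1 else q0) \<noteq> 0" using q by (auto simp: prod_zero_iff)
    ultimately show "(\<lambda>n. of_bool (e k) / (\<Prod>j\<le>k. if e j then y n else x n))
        \<longlonglongrightarrow> of_bool (e k) / (\<Prod>j\<le>k. if e j then q1 else q0)"
      by (intro tendsto_intros)
    have "\<forall>\<^sub>F n in sequentially. \<forall>j\<in>{..k}. d n j = e j"
      using d by (intro eventually_ball_finite) auto
    then show "\<forall>\<^sub>F n in sequentially. of_bool (e k) / (\<Prod>j\<le>k. if e j then y n else x n) = g k n"
      by eventually_elim (auto simp: g_def intro!: prod.cong)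
  qed
  moreover have "\<forall>\<^sub>F (k, n) in at_top \<times>\<^sub>F sequentially. norm (g k n) \<le> (1 / c) ^ Suc k"
  proof -
    have "\<forall>\<^sub>F n in sequentially. c < x n \<and> c < y n"
      using ev_x ev_y by (rule eventually_conj)
    then have "\<forall>\<^sub>F n in sequentially. \<forall>k. norm (g k n) \<le> (1 / c) ^ Suc k"
    proof eventually_elim
      case (elim n)
      show ?case
        unfolding g_def real_norm_def using elim by (intro allI dbe_term_bound c(1)) auto
    qed
    then show ?thesis
      unfolding eventually_prod_filter
      by (intro exI[of _ "\<lambda>_. True"] exI[of _ "\<lambda>n. \<forall>k. norm (g k n) \<le> (1 / c) ^ Suc k"]) auto
  qed
  ultimately have "(\<lambda>n. \<Sum>k. g k n) \<longlonglongrightarrow> (\<Sum>k. of_bool (e k) / (\<Prod>j\<le>k. if e j then q1 else q0))"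
    using tannerys_theorem[OF _ _ summable_geometric_Suc[OF c(1)]] by fastforce
  then have "(\<lambda>n. dbe_value (x n) (y n) (d n)) \<longlonglongrightarrow> dbe_value q0 q1 e"
    by (simp add: g_def dbe_value_def)
  then show ?thesis
    unfolding nval_def using y by (intro tendsto_intros)
qed

text \<open>Bernoulli's inequality for \<open>(1 - u)\<^sup>n\<close>. The bound on \<open>u\<close> leaves room for the exponents up to \<open>N + 1\<close>
  that occur below and also gives \<open>u \<le> 1 / 8\<close>.\<close>

lemma inverse_power_ge_three_quarters:
  fixes u :: real
  assumes u: "0 \<le> u" "u \<le> 1 / (4 * (real N + 2))" and n: "n \<le> N + 2"
  shows "3 / 4 \<le> 1 / (1 + u) ^ n"
proof -
  have "u \<le> 1 / 8" using u(2) by (rule order_trans) (simp add: field_simps)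
  have "real n * u \<le> (real N + 2) * (1 / (4 * (real N + 2)))"
    using u n by (intro mult_mono) auto
  also have "\<dots> = 1 / 4" by (simp add: field_simps)
  finally have "3 / 4 \<le> 1 + real n * (- u)" by simp
  also have "\<dots> \<le> (1 + - u) ^ n" using \<open>u \<le> 1 / 8\<close> by (intro Bernoulli_inequality) simp
  also have "\<dots> \<le> (1 / (1 + u)) ^ n"
    using u \<open>u \<le> 1 / 8\<close> by (intro power_mono) (auto simp: field_simps)
  finally show ?thesis by (simp add: power_one_over)
qed

text \<open>If \<open>q0\<close> is close to 1, leading zeros cost almost nothing, so the values of \<open>a\<close> and of the
  negation of \<open>b\<close> are almost \<open>1 - 1 / q1\<close> or more. The first inequality then forces
  \<open>q1\<close> to be large, hence both values to exceed 1/2, whereas the two inequalities together bound their sum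
  by 1. The bound depends on the sequences only through the position of one digit in each, hence is uniform
  over sequences with a common prefix. Inequalities take the place of the two equations because the proof of
  existence has to exclude points where only these are known.\<close>

lemma base_lower_bound:
  assumes q: "1 < q0" "1 < q1" and N: "a k" "k \<le> N" "\<not> b m" "m \<le> N"
    and le: "nval q0 q1 a \<le> (q0 - 1) * (q1 - 1)" "(q0 - 1) * (q1 - 1) \<le> nval q1 q0 b"
  shows "1 / (4 * (real N + 2)) < q0 - 1"
proof (rule ccontr)
  assume "\<not> ?thesis"
  then have small: "q0 - 1 \<le> 1 / (4 * (real N + 2))" by simp
  define X where "X = 1 / q0 ^ N"
  have X: "3 / 4 \<le> X"
    using inverse_power_ge_three_quarters[OF _ small, of N] q by (simp add: X_def)
  have lower: "(1 - 1 / q1) * X \<le> nval q0 q1 a" "(1 - 1 / q1) * X \<le> nval q0 q1 (flip b)"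
    using nval_lower_bound[OF q, of a k N] nval_lower_bound[OF q, of "flip b" m N] N
    by (auto simp: X_def flip_def)
  have eq: "(1 - 1 / q1) * X = (q1 - 1) * (X / q1)" using q by (simp add: field_simps)
  then have "(q1 - 1) * (X / q1) \<le> (q1 - 1) * (q0 - 1)" using lower(1) le(1) by (simp add: mult.commute)
  then have "X / q1 \<le> q0 - 1" by (rule mult_left_le_imp_le) (use q in simp)
  also have "q0 - 1 \<le> 1 / 8" using small by (rule order_trans) (simp add: field_simps)
  finally have "8 * X \<le> q1" using q by (simp add: field_simps)
  then have "6 \<le> q1" using X by linarith
  then have "5 / 6 \<le> 1 - 1 / q1" by (simp add: field_simps)
  then have "5 / 6 * (3 / 4) \<le> (1 - 1 / q1) * X" using X by (intro mult_mono) auto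
  then have "1 / 2 < (1 - 1 / q1) * X" by linarith
  then have "1 < nval q0 q1 a + nval q0 q1 (flip b)" using lower by linarith
  moreover have "nval q1 q0 b = 1 - nval q0 q1 (flip b)" using nval_flip[OF q, of "flip b"] by simp
  ultimately show False using le by linarith
qed

lemma nonconst_bound:
  fixes a b :: bseq
  assumes "a \<noteq> (\<lambda>_. False)" "a \<noteq> (\<lambda>_. True)" "b \<noteq> (\<lambda>_. False)" "b \<noteq> (\<lambda>_. True)"
  obtains N where "\<exists>k\<le>N. a k" "\<exists>k\<le>N. \<not> a k" "\<exists>k\<le>N. b k" "\<exists>k\<le>N. \<not> b k"
proof -
  obtain i j k l where "a i" "\<not> a j" "b k" "\<not> b l" using assms by (auto simp: fun_eq_iff)
  then show ?thesis
    by (intro that[of "i + j + k + l"]) (meson le_add1 le_add2 order_trans)+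
qed

text \<open>Solutions are the fixed points of
  \<open>(q0, q1) \<mapsto> (1 + \<pi>\<^bsub>q0,q1\<^esub>(a), 1 + \<pi>\<^bsub>q1,q0\<^esub>(b))\<close>. On the square
  \<open>[1 + \<delta>, 1 + 1/\<delta>]\<^sup>2\<close> the values respect the upper bound; enforcing the lower bound by a
  maximum with \<open>\<delta>\<close> gives a map to which Brouwer's theorem applies. At a fixed point the maximum is not
  attained by \<open>\<delta>\<close> alone: in one coordinate this contradicts \<open>base_lower_bound\<close>, and in both
  coordinates it contradicts the lower bound of values for bases near 1.\<close>

lemma ex_solves:
  assumes ab: "a \<noteq> (\<lambda>_. False)" "a \<noteq> (\<lambda>_. True)" "b \<noteq> (\<lambda>_. False)" "b \<noteq> (\<lambda>_. True)"
  shows "\<exists>q0 q1. solves a b q0 q1"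
proof -
  obtain N where N: "\<exists>k\<le>N. a k" "\<exists>k\<le>N. \<not> a k" "\<exists>k\<le>N. b k" "\<exists>k\<le>N. \<not> b k"
    using nonconst_bound[OF ab] .
  define \<delta> where "\<delta> = 1 / (4 * (real N + 2))"
  have \<delta>: "0 < \<delta>" "\<delta> \<le> 1 / 8" by (auto simp: \<delta>_def field_simps)
  have "\<delta> * \<delta> \<le> 1 * 1" using \<delta> by (intro mult_mono) auto
  then have "\<delta> \<le> 1 / \<delta>" using \<delta> by (simp add: pos_le_divide_eq)
  define K where "K = {1 + \<delta> .. 1 + 1 / \<delta>} \<times> {1 + \<delta> .. 1 + 1 / \<delta>}"
  define F where "F = (\<lambda>(q0, q1). (1 + max \<delta> (nval q0 q1 a / (q1 - 1)), 1 + max \<delta> (nval q1 q0 b / (q0 - 1))))"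
  have K_gt: "1 < fst p" "1 < snd p" if "p \<in> K" for p using that \<delta> by (auto simp: K_def)
  have cont: "continuous_on K (\<lambda>p. nval (fst p) (snd p) a)" "continuous_on K (\<lambda>p. nval (snd p) (fst p) b)"
    unfolding continuous_on_sequentially o_def
    by (intro allI ballI impI nval_tendsto tendsto_intros K_gt; force)+
  have "continuous_on K F"
    unfolding F_def split_beta using K_gt by (intro continuous_intros cont) fastforce+
  moreover have "F p \<in> K" if "p \<in> K" for p
  proof -
    have bd: "w / (x - 1) \<le> 1 / \<delta>" if "0 \<le> w" "w \<le> 1" "1 + \<delta> \<le> x" for w x
      using that \<delta> by (intro frac_le) auto
    obtain x y where p: "p = (x, y)" by (cases p)
    have "1 + \<delta> \<le> x" "1 + \<delta> \<le> y" "1 < x" "1 < y" using \<open>p \<in> K\<close> \<delta> by (auto simp: K_def p)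
    then show ?thesis
      using bd \<open>\<delta> \<le> 1 / \<delta>\<close> nval_nonneg nval_le_1 by (simp add: F_def K_def p)
  qed
  moreover have "compact K" "convex K" "K \<noteq> {}"
    using \<open>\<delta> \<le> 1 / \<delta>\<close> by (auto simp: K_def intro!: compact_Times convex_Times)
  ultimately obtain p where p: "p \<in> K" "F p = p" using brouwer[of K F] by blast
  obtain q0 q1 where pq: "p = (q0, q1)" by (cases p)
  have q: "1 < q0" "1 < q1" using K_gt[OF p(1)] by (auto simp: pq)
  define x where "x = nval q0 q1 a / (q1 - 1)"
  define y where "y = nval q1 q0 b / (q0 - 1)"
  have fix_x: "q0 - 1 = max \<delta> x" and fix_y: "q1 - 1 = max \<delta> y" using p(2) by (auto simp: F_def pq x_def y_def)
  have a_eq: "nval q0 q1 a = x * (q1 - 1)" and b_eq: "nval q1 q0 b = (q0 - 1) * y"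
    using q by (simp_all add: x_def y_def)
  \<comment> \<open>A truncated coordinate turns its equation into an inequality.\<close>
  have le_x: "nval q0 q1 a \<le> (q0 - 1) * (q1 - 1)"
    unfolding a_eq using fix_x q by (intro mult_right_mono) auto
  have le_y: "nval q1 q0 b \<le> (q1 - 1) * (q0 - 1)"
    unfolding b_eq using fix_y q by (simp add: mult.commute mult_right_mono)
  have eq_x: "x = q0 - 1" if "y = q1 - 1"
  proof (rule ccontr)
    assume "x \<noteq> q0 - 1"
    then have "q0 - 1 = \<delta>" using fix_x by linarith
    moreover have "(q0 - 1) * (q1 - 1) \<le> nval q1 q0 b" unfolding b_eq that by simp
    ultimately show False using base_lower_bound[OF q _ _ _ _ le_x] N unfolding \<delta>_def by fastforce
  qed
  have eq_y: "y = q1 - 1" if "x = q0 - 1"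
  proof (rule ccontr)
    assume "y \<noteq> q1 - 1"
    then have "q1 - 1 = \<delta>" using fix_y by linarith
    moreover have "(q1 - 1) * (q0 - 1) \<le> nval q0 q1 a" unfolding a_eq that by (simp add: mult.commute)
    ultimately show False using base_lower_bound[OF q(2,1) _ _ _ _ le_y] N unfolding \<delta>_def by fastforce
  qed
  have "x = q0 - 1 \<or> y = q1 - 1"
  proof (rule ccontr)
    assume "\<not> ?thesis"
    then have q_eq: "q0 = 1 + \<delta>" "q1 = 1 + \<delta>" and "x \<le> \<delta>" using fix_x fix_y by linarith+
    obtain k where "a k" "k \<le> N" using N by blast
    then have "(1 - 1 / q1) / q0 ^ N \<le> x * (q1 - 1)"
      unfolding a_eq[symmetric] by (rule nval_lower_bound[OF q])
    moreover have "(1 - 1 / z) / z ^ N = 1 / z ^ (N + 1) * (z - 1)" if "0 < z" for z :: real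
      using that by (simp add: divide_simps)
    then have "(1 - 1 / q1) / q0 ^ N = 1 / (1 + \<delta>) ^ (N + 1) * (q1 - 1)"
      using \<delta>(1) unfolding q_eq by simp
    ultimately have "1 / (1 + \<delta>) ^ (N + 1) * (q1 - 1) \<le> x * (q1 - 1)" by simp
    then have "1 / (1 + \<delta>) ^ (N + 1) \<le> x" by (rule mult_right_le_imp_le) (use q in simp)
    moreover have "3 / 4 \<le> 1 / (1 + \<delta>) ^ (N + 1)"
      by (rule inverse_power_ge_three_quarters[of _ N]) (use \<delta> in \<open>auto simp: \<delta>_def\<close>)
    ultimately show False using \<open>x \<le> \<delta>\<close> \<delta> by linarith
  qed
  then have "x = q0 - 1" "y = q1 - 1" using eq_x eq_y by auto
  then have "solves a b q0 q1" using q a_eq b_eq by (simp add: solves_def)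
  then show ?thesis by blast
qed

lemma seqB_nonconst:
  assumes "(\<mu>, \<alpha>) \<in> seqB"
  shows "shift \<alpha> \<noteq> (\<lambda>_. False)" "shift \<alpha> \<noteq> (\<lambda>_. True)"
    "flip (shift \<mu>) \<noteq> (\<lambda>_. False)" "flip (shift \<mu>) \<noteq> (\<lambda>_. True)"
proof -
  note S = assms[unfolded seqB_iff]
  have tail: "shift d = (\<lambda>_. c) \<Longrightarrow> d (Suc n) = c" for d c n by (metis shift_def)
  show "shift \<alpha> \<noteq> (\<lambda>_. False)"
  proof
    assume "shift \<alpha> = (\<lambda>_. False)"
    then have "\<not> \<alpha> k" if "k > 0" for k using tail that by (metis gr0_implies_Suc)
    then show False using S unfolding finite_seq_def by blast
  qed
  show "shift \<alpha> \<noteq> (\<lambda>_. True)"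
  proof
    assume "shift \<alpha> = (\<lambda>_. True)"
    then have "\<alpha> k" for k using tail S by (cases k) auto
    then show False using S by blast
  qed
  show "flip (shift \<mu>) \<noteq> (\<lambda>_. False)"
  proof
    assume "flip (shift \<mu>) = (\<lambda>_. False)"
    then have "shift \<mu> = (\<lambda>_. True)" by (auto simp: flip_def fun_eq_iff)
    then have "\<mu> k" if "k > 0" for k using tail that by (metis gr0_implies_Suc)
    then show False using S unfolding cofinite_seq_def finite_seq_def by blast
  qed
  show "flip (shift \<mu>) \<noteq> (\<lambda>_. True)"
  proof
    assume "flip (shift \<mu>) = (\<lambda>_. True)"
    then have "shift \<mu> = (\<lambda>_. False)" by (auto simp: flip_def fun_eq_iff)
    then have "\<not> \<mu> k" for k using tail S by (cases k) auto
    then show False using S by blast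
  qed
qed

lemma bij_betw_Phi: "bij_betw Phi baseB seqB"
proof (rule bij_betw_imageI)
  show "inj_on Phi baseB"
  proof (rule inj_onI)
    fix p q assume pB: "p \<in> baseB" and qB: "q \<in> baseB" and eq: "Phi p = Phi q"
    obtain p0 p1 q0 q1 where pq: "p = (p0, p1)" "q = (q0, q1)" by (cases p; cases q)
    obtain \<mu> \<alpha> where Phi: "Phi q = (\<mu>, \<alpha>)" by (cases "Phi q")
    have "(\<mu>, \<alpha>) \<in> seqB" using Phi_in_seqB qB Phi by (metis pq(2))
    moreover have "solves (shift \<alpha>) (flip (shift \<mu>)) q0 q1" "solves (shift \<alpha>) (flip (shift \<mu>)) p0 p1"
      using solves_Phi[of q0 q1] solves_Phi[of p0 p1] pB qB eq Phi unfolding pq by auto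
    ultimately show "p = q" using solves_unique seqB_nonconst unfolding pq by blast
  qed
  show "Phi ` baseB = seqB"
  proof (intro equalityI subsetI)
    fix S assume "S \<in> Phi ` baseB"
    then show "S \<in> seqB" using Phi_in_seqB by auto
  next
    fix S assume "S \<in> seqB"
    then obtain \<mu> \<alpha> where S: "S = (\<mu>, \<alpha>)" "(\<mu>, \<alpha>) \<in> seqB" by (cases S) auto
    obtain q0 q1 where "solves (shift \<alpha>) (flip (shift \<mu>)) q0 q1"
      using ex_solves[OF seqB_nonconst[OF S(2)]] by blast
    then show "S \<in> Phi ` baseB" using Phi_eqI[OF S(2)] S(1) by (metis image_eqI)
  qed
qed

lemma Phi_inv_image:
  assumes "S \<subseteq> seqB"
  shows "Phi_inv ` S = {q \<in> baseB. Phi q \<in> S}"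
proof -
  have inj: "inj_on Phi baseB" and img: "Phi ` baseB = seqB"
    using bij_betw_Phi by (auto simp: bij_betw_def)
  have inv: "Phi_inv (Phi q) = q" if "q \<in> baseB" for q
    unfolding Phi_inv_def by (rule inv_into_f_f[OF inj that])
  show ?thesis
  proof (intro equalityI subsetI)
    fix q assume "q \<in> Phi_inv ` S"
    then obtain s where s: "s \<in> S" "q = Phi_inv s" by blast
    then obtain p where "p \<in> baseB" "s = Phi p" using assms img by blast
    then show "q \<in> {q \<in> baseB. Phi q \<in> S}" using s inv by simp
  next
    fix q assume "q \<in> {q \<in> baseB. Phi q \<in> S}"
    then show "q \<in> Phi_inv ` S" using inv by (metis (mono_tags, lifting) image_eqI mem_Collect_eq)
  qed
qed

section \<open>Closures\<close>

text \<open>Compactness of the sequence space: pass to subsequences coordinate by coordinate and take the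
  diagonal.\<close>

lemma seq_convergent_subseq:
  fixes f :: "nat \<Rightarrow> bseq"
  obtains r g where "strict_mono r" "\<And>i. \<forall>\<^sub>F k in sequentially. f (r k) i = g i"
proof -
  define P where "P i s \<longleftrightarrow> (\<exists>b. \<forall>\<^sub>F k in sequentially. f (s k) i = b)" for i and s :: "nat \<Rightarrow> nat"
  interpret subseqs P
  proof
    fix i and s :: "nat \<Rightarrow> nat"
    show "\<exists>r. strict_mono r \<and> P i (s \<circ> r)"
    proof (cases "finite {k. f (s k) i}")
      case True
      then have "\<forall>\<^sub>F k in sequentially. f (s k) i = False"
        using eventually_cofinite[of "\<lambda>k. \<not> f (s k) i"] by (simp add: cofinite_eq_sequentially)
      then have "P i (s \<circ> id)" unfolding P_def by (intro exI[of _ False]) simp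
      then show ?thesis using strict_mono_id by blast
    next
      case False
      have "P i (s \<circ> enumerate {k. f (s k) i})"
        unfolding P_def using enumerate_in_set[OF False] by (intro exI[of _ True]) simp
      then show ?thesis using strict_mono_enumerate[OF False] by blast
    qed
  qed
  have stable: "P i (s \<circ> r)" if "strict_mono r" "P i s" for r s i
    using that eventually_subseq[of r] unfolding P_def o_def by blast
  have "\<exists>b. \<forall>\<^sub>F k in sequentially. f (diagseq k) i = b" for i
  proof -
    have "P i (diagseq \<circ> ((+) (Suc i)))" using diagseq_holds[OF stable] by blast
    then obtain b where "\<forall>\<^sub>F k in sequentially. f (diagseq (k + Suc i)) i = b"
      unfolding P_def o_def by (auto simp: add.commute)
    then have "\<forall>\<^sub>F k in sequentially. f (diagseq k) i = b"
      unfolding eventually_sequentially_seg[of "\<lambda>k. f (diagseq k) i = b"] .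
    then show ?thesis by blast
  qed
  then obtain g where "\<And>i. \<forall>\<^sub>F k in sequentially. f (diagseq k) i = g i" by metis
  then show ?thesis using that subseq_diagseq by blast
qed

lemma seq_dist_less_iff: "seq_dist c e < (1 / 2) ^ N \<longleftrightarrow> (\<forall>i<N. c i = e i)"
proof (cases "c = e")
  case True
  then show ?thesis by (simp add: seq_dist_def)
next
  case False
  define L where "L = (LEAST i. c i \<noteq> e i)"
  obtain k where "c k \<noteq> e k" using False by auto
  then have "c L \<noteq> e L" unfolding L_def by (rule LeastI)
  moreover have "c i = e i" if "i < L" for i using not_less_Least that unfolding L_def by blast
  ultimately have "(\<forall>i<N. c i = e i) \<longleftrightarrow> N \<le> L" by (meson linorder_not_less order_less_le_trans)
  also have "\<dots> \<longleftrightarrow> (1 / 2 :: real) ^ Suc L < (1 / 2) ^ N"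
    by (subst power_strict_decreasing_iff) (auto simp: less_Suc_eq_le)
  finally show ?thesis using False by (simp add: seq_dist_def L_def)
qed

lemma seq_closure_iff:
  "(c, e) \<in> seq_closure S \<longleftrightarrow> (\<forall>N. \<exists>(c', e')\<in>S. \<forall>i<N. c i = c' i \<and> e i = e' i)"
proof -
  interpret M: Metric_space UNIV "max_dist seq_dist seq_dist"
    by (intro Metric_space_max_dist Metric_space_seq_dist)
  have dist: "max_dist seq_dist seq_dist (c, e) (c', e') < (1 / 2) ^ N
      \<longleftrightarrow> (\<forall>i<N. c i = c' i \<and> e i = e' i)" for c' e' N
    by (auto simp: max_dist_def seq_dist_less_iff)
  have "(c, e) \<in> seq_closure S \<longleftrightarrow> (\<forall>r>0. \<exists>y\<in>S. max_dist seq_dist seq_dist (c, e) y < r)"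
    by (simp add: M.metric_closure_of)
  also have "\<dots> \<longleftrightarrow> (\<forall>N. \<exists>y\<in>S. max_dist seq_dist seq_dist (c, e) y < (1 / 2) ^ N)"
  proof (intro iffI allI impI)
    fix r :: real
    assume *: "\<forall>N. \<exists>y\<in>S. max_dist seq_dist seq_dist (c, e) y < (1 / 2) ^ N" and "0 < r"
    obtain N where "(1 / 2) ^ N < r" using real_arch_pow_inv[OF \<open>0 < r\<close>, of "1 / 2"] by auto
    then show "\<exists>y\<in>S. max_dist seq_dist seq_dist (c, e) y < r" using * by (meson less_trans)
  qed simp
  also have "\<dots> \<longleftrightarrow> (\<forall>N. \<exists>(c', e')\<in>S. \<forall>i<N. c i = c' i \<and> e i = e' i)"
    unfolding dist[symmetric] by (simp add: split_beta)
  finally show ?thesis .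
qed

lemma seq_closure_of_limit:
  assumes S: "\<And>k. (c k, e k) \<in> S"
    and "\<And>i. \<forall>\<^sub>F k in sequentially. c k i = c' i" "\<And>i. \<forall>\<^sub>F k in sequentially. e k i = e' i"
  shows "(c', e') \<in> seq_closure S"
  unfolding seq_closure_iff
proof
  fix N
  have "\<forall>\<^sub>F k in sequentially. \<forall>i\<in>{..<N}. c k i = c' i"
    "\<forall>\<^sub>F k in sequentially. \<forall>i\<in>{..<N}. e k i = e' i"
    using assms by (intro eventually_ball_finite; simp)+
  then have "\<forall>\<^sub>F k in sequentially. (\<forall>i<N. c k i = c' i) \<and> (\<forall>i<N. e k i = e' i)"
    by eventually_elim auto
  then obtain k where "(\<forall>i<N. c k i = c' i) \<and> (\<forall>i<N. e k i = e' i)"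
    using eventually_happens' sequentially_bot by blast
  then show "\<exists>(c'', e'')\<in>S. \<forall>i<N. c' i = c'' i \<and> e' i = e'' i"
    using S[of k] by (intro bexI[of _ "(c k, e k)"]) auto
qed

text \<open>Strict lexicographic inequalities are open conditions, hence weak ones are closed.\<close>

lemma lex_less_prefix:
  assumes "c \<prec>\<^sub>l e"
  obtains N where "\<And>c' e'. (\<And>i. i < N \<Longrightarrow> c i = c' i) \<Longrightarrow> (\<And>i. i < N \<Longrightarrow> e i = e' i) \<Longrightarrow> c' \<prec>\<^sub>l e'"
proof -
  obtain k where k: "\<not> c k" "e k" "\<forall>i<k. c i = e i" using assms unfolding lex_less_iff by blast
  show ?thesis
  proof (rule that[of "Suc k"])
    fix c' e' :: bseq
    assume c: "\<And>i. i < Suc k \<Longrightarrow> c i = c' i" and e: "\<And>i. i < Suc k \<Longrightarrow> e i = e' i"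
    show "c' \<prec>\<^sub>l e'"
      unfolding lex_less_iff
    proof (intro exI[of _ k] conjI allI impI)
      show "\<not> c' k" "e' k" using k c[of k] e[of k] by auto
      show "c' i = e' i" if "i < k" for i using k(3) c[of i] e[of i] that by auto
    qed
  qed
qed

text \<open>A weak inequality between tails passes to the closure, since its strict converse would already hold
  for nearby pairs. The projections \<open>f\<close> and \<open>g\<close> select which components are compared.\<close>

lemma seq_closure_lex_le:
  assumes cl: "(c, e) \<in> seq_closure S"
    and le: "\<And>c e. (c, e) \<in> S \<Longrightarrow> (shift ^^ m) (f c e) \<preceq>\<^sub>l (shift ^^ n) (g c e)"
    and f: "f = (\<lambda>c e. c) \<or> f = (\<lambda>c e. e)" and g: "g = (\<lambda>c e. c) \<or> g = (\<lambda>c e. e)"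
  shows "(shift ^^ m) (f c e) \<preceq>\<^sub>l (shift ^^ n) (g c e)"
proof (rule ccontr)
  assume "\<not> ?thesis"
  then obtain N where N: "\<And>c' e'. (\<And>i. i < N \<Longrightarrow> ((shift ^^ n) (g c e)) i = c' i) \<Longrightarrow>
      (\<And>i. i < N \<Longrightarrow> ((shift ^^ m) (f c e)) i = e' i) \<Longrightarrow> c' \<prec>\<^sub>l e'"
    using lex_less_prefix[of "(shift ^^ n) (g c e)" "(shift ^^ m) (f c e)"]
    unfolding lex_le_iff_not_less by blast
  obtain c' e' where S: "(c', e') \<in> S" and eq: "\<And>i. i < N + m + n \<Longrightarrow> c i = c' i \<and> e i = e' i"
    using cl unfolding seq_closure_iff by blast
  have "(shift ^^ n) (g c' e') \<prec>\<^sub>l (shift ^^ m) (f c' e')"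
    by (rule N) (use f g eq in \<open>auto simp: funpow_shift\<close>)
  then show False using le[OF S] by (simp add: lex_le_iff_not_less)
qed

lemma seq_closure_seqU_subset: "seq_closure seqU \<subseteq> seqV"
proof
  fix p assume p: "p \<in> seq_closure seqU"
  obtain \<mu> \<alpha> where [simp]: "p = (\<mu>, \<alpha>)" by (cases p)
  have U: "(shift ^^ 0) m \<preceq>\<^sub>l (shift ^^ n) m" "(shift ^^ n) m \<preceq>\<^sub>l (shift ^^ 0) a"
    "(shift ^^ 0) m \<preceq>\<^sub>l (shift ^^ n) a" "(shift ^^ n) a \<preceq>\<^sub>l (shift ^^ 0) a" if "(m, a) \<in> seqU" for m a n
  proof -
    have "m \<prec>\<^sub>l a" unfolding lex_less_iff
      using that by (intro exI[of _ 0]) (auto simp: seqU_def Sigma0_def Sigma1_def)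
    then show "(shift ^^ 0) m \<preceq>\<^sub>l (shift ^^ n) m" "(shift ^^ n) m \<preceq>\<^sub>l (shift ^^ 0) a"
      "(shift ^^ 0) m \<preceq>\<^sub>l (shift ^^ n) a" "(shift ^^ n) a \<preceq>\<^sub>l (shift ^^ 0) a"
      using that by (cases "n = 0"; auto simp: lex_le_def seqU_def Suc_le_eq)+
  qed
  note cl = seq_closure_lex_le[OF p[unfolded \<open>p = (\<mu>, \<alpha>)\<close>]]
  have "\<mu> \<preceq>\<^sub>l (shift ^^ n) \<mu> \<and> (shift ^^ n) \<mu> \<preceq>\<^sub>l \<alpha> \<and> \<mu> \<preceq>\<^sub>l (shift ^^ n) \<alpha> \<and> (shift ^^ n) \<alpha> \<preceq>\<^sub>l \<alpha>" for n
    using cl[of 0 "\<lambda>c e. c" n "\<lambda>c e. c"] cl[of n "\<lambda>c e. c" 0 "\<lambda>c e. e"]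
      cl[of 0 "\<lambda>c e. c" n "\<lambda>c e. e"] cl[of n "\<lambda>c e. e" 0 "\<lambda>c e. e"] U by simp
  moreover have "\<exists>(m, a)\<in>seqU. \<forall>i<1. \<mu> i = m i \<and> \<alpha> i = a i"
    using p unfolding \<open>p = (\<mu>, \<alpha>)\<close> seq_closure_iff by (rule spec)
  then obtain m a where "(m, a) \<in> seqU" "\<mu> 0 = m 0" "\<alpha> 0 = a 0" by auto
  ultimately show "p \<in> seqV" by (auto simp: seqV_def seqU_def Sigma0_def Sigma1_def)
qed

lemma seqV_minus_seqC_subset: "seqV - seqC \<subseteq> seqB"
  by (auto simp: seqV_def seqB_def)

lemma not_True_lex_less: "\<not> (\<lambda>_. True) \<prec>\<^sub>l c"
  and not_lex_less_False: "\<not> c \<prec>\<^sub>l (\<lambda>_. False)"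
  by (auto simp: lex_less_iff)

lemma seqC_cases:
  assumes "(\<mu>, \<alpha>) \<in> seqC"
  obtains "\<mu> = (\<lambda>_. False)" | n where "(shift ^^ Suc n) \<mu> = (\<lambda>_. True)"
    | "\<alpha> = (\<lambda>_. True)" | n where "(shift ^^ Suc n) \<alpha> = (\<lambda>_. False)"
proof -
  have tail: "(shift ^^ Suc n) d = (\<lambda>_. b)" if "\<forall>k>n. d k = b" for d n b
    unfolding funpow_shift using that by auto
  consider "\<mu> = (\<lambda>_. False)" | n where "\<forall>k>n. \<mu> k = True"
    | "\<alpha> = (\<lambda>_. True)" | n where "\<forall>k>n. \<alpha> k = False"
    using assms by (auto simp: seqC_def)
  then show ?thesis
  proof cases
    case 1
    then show ?thesis by (rule that(1))
  next
    case (2 n)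
    show ?thesis by (rule that(2)[OF tail[OF 2]])
  next
    case 3
    then show ?thesis by (rule that(3))
  next
    case (4 n)
    show ?thesis by (rule that(4)[OF tail[OF 4]])
  qed
qed

lemma seqU_subset: "seqU \<subseteq> seqV - seqC"
proof
  fix p assume p: "p \<in> seqU"
  obtain \<mu> \<alpha> where [simp]: "p = (\<mu>, \<alpha>)" by (cases p)
  have "p \<in> seq_closure seqU" unfolding \<open>p = (\<mu>, \<alpha>)\<close> seq_closure_iff using p by (auto intro!: bexI[of _ p])
  then have "p \<in> seqV" using seq_closure_seqU_subset by blast
  have U: "\<mu> \<prec>\<^sub>l (shift ^^ n) \<mu>" "(shift ^^ n) \<mu> \<prec>\<^sub>l \<alpha>" "\<mu> \<prec>\<^sub>l (shift ^^ n) \<alpha>" "(shift ^^ n) \<alpha> \<prec>\<^sub>l \<alpha>" if "1 \<le> n" for n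
    using p that by (auto simp: seqU_def)
  have "p \<notin> seqC"
  proof
    assume "p \<in> seqC"
    then have "(\<mu>, \<alpha>) \<in> seqC" by simp
    then show False
    proof (cases rule: seqC_cases)
      case 1
      show False using U(1)[of 1] unfolding 1 by (simp add: shift_def not_lex_less_False)
    next
      case (2 n)
      show False using U(2)[of "Suc n"] unfolding 2 by (simp add: not_True_lex_less)
    next
      case 3
      show False using U(4)[of 1] unfolding 3 by (simp add: shift_def not_True_lex_less)
    next
      case (4 n)
      show False using U(3)[of "Suc n"] unfolding 4 by (simp add: not_lex_less_False)
    qed
  qed
  with \<open>p \<in> seqV\<close> show "p \<in> seqV - seqC" by blast
qed

section \<open>The three equalities\<close>

lemma admissible_iff: "1 < q0 \<and> 1 < q1 \<and> q0 + q1 \<ge> q0 * q1 \<longleftrightarrow> (q0, q1) \<in> baseB \<union> baseC"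
  by (auto simp: baseB_def baseC_def)

lemma admissible_thr:
  assumes "(q0, q1) \<in> baseB \<union> baseC"
  shows "1 < q0" "1 < q1" "thr q0 q1 \<le> 1"
  using assms thr_le_1_iff[of q0 q1] unfolding admissible_iff[symmetric] by (auto simp: algebra_simps)

lemma baseC_seqs:
  assumes "(q0, q1) \<in> baseC"
  shows "thr q0 q1 = 1" "alpha_seq q0 q1 = (\<lambda>_. True)" "mu_seq q0 q1 = (\<lambda>_. False)"
proof -
  have q: "1 < q0" "1 < q1" using assms by (auto simp: baseC_def)
  have thr: "thr x y = 1" if "(x, y) \<in> baseC" for x y
    using that by (auto simp: baseC_def thr_def field_simps)
  have alpha: "alpha_seq x y = (\<lambda>_. True)" if "(x, y) \<in> baseC" for x y
  proof (rule alpha_seqI)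
    show xy: "1 < x" "1 < y" using that by (auto simp: baseC_def)
    show "nval x y (\<lambda>_. True) = thr x y" using nval_True[OF xy] thr[OF that] by simp
  qed (auto simp: finite_seq_def greedy_def)
  have sym: "(q1, q0) \<in> baseC" using assms by (auto simp: baseC_def algebra_simps)
  show "thr q0 q1 = 1" "alpha_seq q0 q1 = (\<lambda>_. True)" using thr alpha assms by auto
  show "mu_seq q0 q1 = (\<lambda>_. False)"
    using mu_seq_eq_flip[OF q] thr[OF assms] alpha[OF sym] by (simp add: flip_def)
qed

lemma baseC_subset_baseU: "baseC \<subseteq> baseU"
proof
  fix p assume p: "p \<in> baseC"
  obtain q0 q1 where pq: "p = (q0, q1)" by (cases p)
  note C = baseC_seqs[OF p[unfolded pq]]
  have q: "1 < q0" "1 < q1" using p by (auto simp: pq baseC_def)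
  have "(q1, q0) \<in> baseC" using p by (auto simp: pq baseC_def algebra_simps)
  then have "thr q1 q0 = 1" using baseC_seqs by blast
  then have "univoque q0 q1 (\<lambda>_. True)" "univoque q0 q1 (\<lambda>_. False)"
    unfolding univoque_def funpow_shift using nval_True[OF q] C(1) by (simp_all add: nval_False)
  then show "p \<in> baseU" using baseU_iff[OF q] C by (simp add: pq)
qed

lemma baseC_subset_baseV: "baseC \<subseteq> baseV"
proof
  fix p assume p: "p \<in> baseC"
  obtain q0 q1 where pq: "p = (q0, q1)" by (cases p)
  have "\<not> (\<lambda>_. True) \<prec>\<^sub>l (\<lambda>_. False)" by (auto simp: lex_less_iff)
  then show "p \<in> baseV"
    using p baseC_seqs[OF p[unfolded pq]]
    by (simp add: pq baseV_def baseC_def funpow_shift lex_le_iff_not_less)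
qed

lemma baseU_eq: "baseU = {q \<in> baseB. Phi q \<in> seqU} \<union> baseC"
proof -
  have "(q0, q1) \<in> baseU \<longleftrightarrow> Phi (q0, q1) \<in> seqU" if B: "(q0, q1) \<in> baseB" for q0 q1
  proof -
    have q: "1 < q0" "1 < q1" and thr: "thr q0 q1 < 1" using B unfolding baseB_iff by auto
    then show ?thesis using baseU_iff[OF q] seqU_iff_univoque[OF q thr] by (simp add: Phi_def)
  qed
  moreover have "baseU \<subseteq> baseB \<union> baseC" by (auto simp: baseU_def baseB_def baseC_def)
  ultimately show ?thesis using baseC_subset_baseU by auto
qed

lemma baseV_eq: "baseV = {q \<in> baseB. Phi q \<in> seqV - seqC} \<union> baseC"
proof -
  have "(q0, q1) \<in> baseV \<longleftrightarrow> Phi (q0, q1) \<in> seqV - seqC" if B: "(q0, q1) \<in> baseB" for q0 q1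
    using Phi_in_seqB[OF B] B by (auto simp: Phi_def seqB_def seqV_def baseV_def baseB_def)
  moreover have "baseV \<subseteq> baseB \<union> baseC" by (auto simp: baseV_def baseB_def baseC_def)
  ultimately show ?thesis using baseC_subset_baseV by auto
qed

text \<open>The remainder behind the first digit of \<open>\<alpha>\<close> has value \<open>P = (q0 - 1) (q1 - 1)\<close>, and this digit is 1;
  uniqueness puts it above the value \<open>(1 - P) / q0\<close> of \<open>ell\<close>.\<close>

lemma baseU_lower:
  assumes "(q0, q1) \<in> baseU"
  shows "1 - (q0 - 1) * (q1 - 1) \<le> q0 * ((q0 - 1) * (q1 - 1))"
proof -
  define P where "P = (q0 - 1) * (q1 - 1)"
  have "(q0, q1) \<in> baseB \<union> baseC" using assms by (auto simp: baseU_def baseB_def baseC_def)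
  note q = admissible_thr(1,2)[OF this] and thr = admissible_thr(3)[OF this]
  have "univoque q0 q1 (alpha_seq q0 q1)" using assms baseU_iff[OF q thr] by simp
  then have "1 - thr q1 q0 < nval q0 q1 ((shift ^^ Suc 0) (alpha_seq q0 q1))"
    using alpha_seq_0[OF q thr] unfolding univoque_def by meson
  also have "\<dots> = P"
    using nval_eq_thr_iff[OF q, of "alpha_seq q0 q1"] alpha_seq_0[OF q thr] alpha_seq_props(1)[OF q thr]
    by (simp add: P_def)
  finally have "1 - thr q1 q0 < P" .
  moreover have "1 - thr q1 q0 = (1 - P) / q0" using q by (simp add: thr_def P_def field_simps)
  ultimately have "1 - P < q0 * P" using q by (simp add: pos_divide_less_eq mult.commute)
  then show ?thesis by (simp add: P_def)
qed

lemma baseU_swap: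
  assumes "(q0, q1) \<in> baseU"
  shows "(q1, q0) \<in> baseU"
proof -
  have "(q0, q1) \<in> baseB \<union> baseC" using assms by (auto simp: baseU_def baseB_def baseC_def)
  note q = admissible_thr(1,2)[OF this] and thr = admissible_thr(3)[OF this]
  have thr': "thr q1 q0 \<le> 1" using thr thr_le_1_commute[OF q] by simp
  show ?thesis
    using assms univoque_flip[OF q] univoque_flip[OF q(2,1)]
    unfolding baseU_iff[OF q thr] baseU_iff[OF q(2,1) thr'] mu_seq_eq_flip[OF q thr] mu_seq_eq_flip[OF q(2,1) thr']
    by metis
qed

text \<open>The inequality of \<open>baseU_lower\<close> and its mirror image survive in the limit, and fail when one
  of the bases is 1.\<close>

lemma closure_baseU_subset: "closure baseU \<subseteq> baseB \<union> baseC"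
proof -
  let ?P = "\<lambda>p :: real \<times> real. (fst p - 1) * (snd p - 1)"
  define D where "D = {p. 1 \<le> fst p} \<inter> {p. 1 \<le> snd p} \<inter> {p. ?P p \<le> 1}
    \<inter> {p. 1 - ?P p \<le> fst p * ?P p} \<inter> {p. 1 - ?P p \<le> snd p * ?P p}"
  have "closed D"
    unfolding D_def by (intro closed_Int closed_Collect_le continuous_intros)
  moreover have "baseU \<subseteq> D"
  proof
    fix p assume p: "p \<in> baseU"
    obtain q0 q1 where pq: "p = (q0, q1)" by (cases p)
    have "(q1 - 1) * (q0 - 1) = (q0 - 1) * (q1 - 1)" by (rule mult.commute)
    then show "p \<in> D"
      using baseU_lower[OF p[unfolded pq]] baseU_lower[OF baseU_swap[OF p[unfolded pq]]] p
      by (auto simp: D_def pq baseU_def algebra_simps)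
  qed
  ultimately have "closure baseU \<subseteq> D" by (rule closure_minimal[rotated])
  moreover have "p \<in> baseB \<union> baseC" if "p \<in> D" for p
  proof -
    have "fst p \<noteq> 1" "snd p \<noteq> 1" using that by (auto simp: D_def)
    then have "1 < fst p" "1 < snd p" "fst p + snd p \<ge> fst p * snd p"
      using that by (auto simp: D_def algebra_simps)
    then show ?thesis using admissible_iff[of "fst p" "snd p"] by simp
  qed
  ultimately show ?thesis by blast
qed

lemma solves_limit:
  assumes sol: "\<And>k. solves (a k) (b k) (x k) (y k)"
    and x: "x \<longlonglongrightarrow> q0" and y: "y \<longlonglongrightarrow> q1" and q: "1 < q0" "1 < q1"
    and a: "\<And>i. \<forall>\<^sub>F k in sequentially. a k i = a' i" and b: "\<And>i. \<forall>\<^sub>F k in sequentially. b k i = b' i"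
  shows "solves a' b' q0 q1"
proof -
  have P: "(\<lambda>k. (x k - 1) * (y k - 1)) \<longlonglongrightarrow> (q0 - 1) * (q1 - 1)"
    using x y by (intro tendsto_intros)
  have A: "(\<lambda>k. (x k - 1) * (y k - 1)) \<longlonglongrightarrow> nval q0 q1 a'"
    using nval_tendsto[where d = a and e = a', OF x y q a] sol by (simp add: solves_def)
  have B: "(\<lambda>k. (x k - 1) * (y k - 1)) \<longlonglongrightarrow> nval q1 q0 b'"
    using nval_tendsto[where d = b and e = b', OF y x q(2,1) b] sol by (simp add: solves_def)
  show ?thesis
    using LIMSEQ_unique[OF A P] LIMSEQ_unique[OF B P] q by (simp add: solves_def)
qed

lemma eventually_shift:
  assumes "\<And>i. \<forall>\<^sub>F k in sequentially. d k i = d' i"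
  shows "\<forall>\<^sub>F k in sequentially. shift (d k) i = shift d' i"
    "\<forall>\<^sub>F k in sequentially. flip (shift (d k)) i = flip (shift d') i"
  using assms[of "Suc i"] by (simp_all add: shift_def flip_def)

text \<open>A limit pair in \<open>seqV\<close> that solves the equations at a point of \<open>baseB\<close> cannot degenerate:
  any pair of \<open>seqC\<close> within \<open>seqV\<close> has \<open>\<mu>\<close> or \<open>\<alpha>\<close> constant, which forces
  \<open>(q0 - 1) (q1 - 1) = 1\<close>.\<close>

lemma solves_seqV_not_seqC:
  assumes V: "(\<mu>, \<alpha>) \<in> seqV" and sol: "solves (shift \<alpha>) (flip (shift \<mu>)) q0 q1"
    and B: "(q0, q1) \<in> baseB"
  shows "(\<mu>, \<alpha>) \<notin> seqC"
proof
  assume C: "(\<mu>, \<alpha>) \<in> seqC"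
  have V': "(shift ^^ n) \<mu> \<preceq>\<^sub>l \<alpha>" "\<mu> \<preceq>\<^sub>l (shift ^^ n) \<alpha>" for n using V by (auto simp: seqV_def)
  from C have "\<mu> = (\<lambda>_. False) \<or> \<alpha> = (\<lambda>_. True)"
  proof (cases rule: seqC_cases)
    case (2 n)
    show ?thesis using V'(1)[of "Suc n"] unfolding 2 by (auto simp: lex_le_def not_True_lex_less)
  next
    case (4 n)
    show ?thesis using V'(2)[of "Suc n"] unfolding 4 by (auto simp: lex_le_def not_lex_less_False)
  qed auto
  moreover have q: "1 < q0" "1 < q1" and P: "(q0 - 1) * (q1 - 1) < 1"
    using B thr_less_1_iff[of q0 q1] unfolding baseB_iff by auto
  moreover have "flip (shift (\<lambda>_. False)) = (\<lambda>_. True)" "shift (\<lambda>_. True) = (\<lambda>_. True)"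
    by (auto simp: flip_def shift_def)
  ultimately show False
    using sol nval_True[OF q] nval_True[OF q(2,1)] unfolding solves_def by auto
qed

text \<open>A subsequence of the pairs of the approximating bases converges. Its limit solves the equations at
  \<open>q\<close>, hence is the pair of \<open>q\<close>.\<close>

lemma closure_imp_Phi_closure:
  assumes B: "q \<in> baseB" and cl: "q \<in> closure baseU"
  shows "Phi q \<in> seq_closure seqU"
proof -
  obtain q0 q1 where qq: "q = (q0, q1)" by (cases q)
  have q: "1 < q0" "1 < q1" and P: "(q0 - 1) * (q1 - 1) < 1"
    using B thr_less_1_iff[of q0 q1] unfolding qq baseB_iff by auto
  obtain x where x: "\<And>n. x n \<in> baseU" "x \<longlonglongrightarrow> q" using cl unfolding closure_sequential by blast
  have lim0: "(\<lambda>n. fst (x n)) \<longlonglongrightarrow> q0" and lim1: "(\<lambda>n. snd (x n)) \<longlonglongrightarrow> q1"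
    using tendsto_fst[OF x(2)] tendsto_snd[OF x(2)] by (simp_all add: qq)
  have "(\<lambda>n. (fst (x n) - 1) * (snd (x n) - 1)) \<longlonglongrightarrow> (q0 - 1) * (q1 - 1)"
    using lim0 lim1 by (intro tendsto_intros)
  then have "\<forall>\<^sub>F n in sequentially. (fst (x n) - 1) * (snd (x n) - 1) < 1"
    using P by (rule order_tendstoD)
  then obtain K where K: "\<And>n. n \<ge> K \<Longrightarrow> (fst (x n) - 1) * (snd (x n) - 1) < 1"
    unfolding eventually_sequentially by blast
  define z where "z n = x (n + K)" for n
  have z: "z n \<in> baseB" "Phi (z n) \<in> seqU" for n
  proof -
    have "z n \<notin> baseC"
      using K[of "n + K"] by (auto simp: z_def baseC_def algebra_simps)
    then show "z n \<in> baseB" "Phi (z n) \<in> seqU" using x(1)[of "n + K"] unfolding baseU_eq z_def by auto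
  qed
  define m where "m n = fst (Phi (z n))" for n
  define a where "a n = snd (Phi (z n))" for n
  obtain r1 \<mu> where r1: "strict_mono r1" and "\<And>i. \<forall>\<^sub>F k in sequentially. m (r1 k) i = \<mu> i"
    using seq_convergent_subseq[of m] by blast
  note m1 = this(2)
  obtain r2 \<alpha> where r2: "strict_mono r2" and a: "\<And>i. \<forall>\<^sub>F k in sequentially. a (r1 (r2 k)) i = \<alpha> i"
    using seq_convergent_subseq[of "\<lambda>k. a (r1 k)"] by blast
  have m: "\<forall>\<^sub>F k in sequentially. m (r1 (r2 k)) i = \<mu> i" for i
    using eventually_subseq[OF r2 m1[of i]] .
  define w where "w k = z (r1 (r2 k))" for k
  have mono: "strict_mono (\<lambda>k. r1 (r2 k) + K)"
    using strict_mono_o[OF r1 r2] by (auto simp: strict_mono_def o_def)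
  have w0: "(\<lambda>k. fst (w k)) \<longlonglongrightarrow> q0" and w1: "(\<lambda>k. snd (w k)) \<longlonglongrightarrow> q1"
    using LIMSEQ_subseq_LIMSEQ[OF lim0 mono] LIMSEQ_subseq_LIMSEQ[OF lim1 mono]
    by (simp_all add: w_def z_def o_def)
  have cl: "(\<mu>, \<alpha>) \<in> seq_closure seqU"
    by (rule seq_closure_of_limit[OF _ m a]) (use z in \<open>simp add: m_def a_def\<close>)
  have "solves (shift (a (r1 (r2 k)))) (flip (shift (m (r1 (r2 k))))) (fst (w k)) (snd (w k))" for k
    using solves_Phi[of "fst (w k)" "snd (w k)"] z(1) by (simp add: w_def a_def m_def)
  then have sol: "solves (shift \<alpha>) (flip (shift \<mu>)) q0 q1"
    by (rule solves_limit[OF _ w0 w1 q eventually_shift(1)[OF a] eventually_shift(2)[OF m]])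
  have V: "(\<mu>, \<alpha>) \<in> seqV" using cl seq_closure_seqU_subset by blast
  then have "(\<mu>, \<alpha>) \<in> seqB"
    using solves_seqV_not_seqC[OF V sol B[unfolded qq]] seqV_minus_seqC_subset by blast
  then have "Phi q = (\<mu>, \<alpha>)" using Phi_eqI(2) sol unfolding qq by blast
  then show ?thesis using cl by simp
qed

text \<open>The bases of nearby pairs stay in a fixed compact square, and each of their limit points solves
  the equations of \<open>q\<close>, hence is \<open>q\<close>.\<close>

lemma Phi_closure_imp_closure:
  assumes B: "q \<in> baseB" and cl: "Phi q \<in> seq_closure seqU"
  shows "q \<in> closure baseU"
proof -
  obtain q0 q1 where qq: "q = (q0, q1)" by (cases q)
  obtain \<mu> \<alpha> where Phi: "Phi q = (\<mu>, \<alpha>)" by (cases "Phi q")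
  define A where "A = shift \<alpha>"
  define C where "C = flip (shift \<mu>)"
  have sol: "solves A C q0 q1" using solves_Phi[of q0 q1] B Phi by (simp add: qq A_def C_def)
  have "(\<mu>, \<alpha>) \<in> seqB" using Phi_in_seqB[of q0 q1] B Phi by (simp add: qq)
  note nonconst = seqB_nonconst[OF this, folded A_def C_def]
  obtain M where M: "\<exists>k\<le>M. A k" "\<exists>k\<le>M. \<not> A k" "\<exists>k\<le>M. C k" "\<exists>k\<le>M. \<not> C k"
    using nonconst_bound[OF nonconst] .
  define \<delta> where "\<delta> = 1 / (4 * (real M + 2))"
  have \<delta>: "0 < \<delta>" by (simp add: \<delta>_def)
  have "\<exists>p. p \<in> baseB \<and> Phi p \<in> seqU \<and> (\<forall>i<N. \<mu> i = fst (Phi p) i \<and> \<alpha> i = snd (Phi p) i)" for N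
  proof -
    obtain c e where ce: "(c, e) \<in> seqU" "\<forall>i<N. \<mu> i = c i \<and> \<alpha> i = e i"
      using cl unfolding Phi seq_closure_iff by blast
    then have "(c, e) \<in> Phi ` baseB"
      using seqU_subset seqV_minus_seqC_subset bij_betw_Phi by (auto simp: bij_betw_def)
    then obtain p where "p \<in> baseB" "Phi p = (c, e)" by (metis imageE)
    then show ?thesis using ce by (intro exI[of _ p]) simp
  qed
  then obtain Q where Q: "\<And>N. Q N \<in> baseB" "\<And>N. Phi (Q N) \<in> seqU"
    "\<And>N i. i < N \<Longrightarrow> \<mu> i = fst (Phi (Q N)) i \<and> \<alpha> i = snd (Phi (Q N)) i" by metis
  \<comment> \<open>Skipping \<open>M + 2\<close> terms makes the shifted sequences agree with \<open>A\<close> and \<open>C\<close> up to index \<open>M\<close>.\<close>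
  define x where "x n = Q (n + M + 2)" for n
  define a where "a n = shift (snd (Phi (x n)))" for n
  define c where "c n = flip (shift (fst (Phi (x n))))" for n
  have sol_x: "solves (a n) (c n) (fst (x n)) (snd (x n))" for n
    using solves_Phi[of "fst (x n)" "snd (x n)"] Q(1) by (simp add: x_def a_def c_def)
  have agree: "a n i = A i" "c n i = C i" if "i < n + M + 1" for n i
    using Q(3)[of "Suc i" "n + M + 2"] that by (auto simp: x_def a_def c_def A_def C_def shift_def flip_def)
  have x_in: "x n \<in> {1 + \<delta> .. 1 + 1 / \<delta>} \<times> {1 + \<delta> .. 1 + 1 / \<delta>}" for n
  proof -
    obtain u v where uv: "x n = (u, v)" by (cases "x n")
    have gt: "1 < u" "1 < v" and P: "(u - 1) * (v - 1) < 1"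
      using Q(1)[of "n + M + 2"] thr_less_1_iff[of u v] uv unfolding x_def by (auto simp: baseB_iff)
    have eqs: "nval u v (a n) = (u - 1) * (v - 1)" "nval v u (c n) = (u - 1) * (v - 1)"
      using sol_x[of n] by (simp_all add: uv solves_def)
    have "a n k = A k \<and> c n k = C k" if "k \<le> M" for k using agree[of k n] that by simp
    then obtain i j k l where a: "a n i" "i \<le> M" "\<not> a n j" "j \<le> M"
      and c: "c n k" "k \<le> M" "\<not> c n l" "l \<le> M" using M by metis
    have "\<delta> < u - 1"
      unfolding \<delta>_def using base_lower_bound[OF gt, of "a n" i M "c n" l] a c by (simp add: eqs)
    moreover have "\<delta> < v - 1"
      unfolding \<delta>_def using base_lower_bound[OF gt(2,1), of "c n" k M "a n" j] a c
      by (simp add: eqs mult.commute)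
    moreover have "y \<le> 1 / \<delta>" if "0 < y" "\<delta> < z" "y * z < 1" for y z :: real
    proof -
      have "y * \<delta> \<le> y * z" using that by (intro mult_left_mono) auto
      then have "y * \<delta> \<le> 1" using that(3) by linarith
      then show ?thesis using \<delta> by (simp add: pos_le_divide_eq)
    qed
    ultimately have "u - 1 \<le> 1 / \<delta>" "v - 1 \<le> 1 / \<delta>" using gt P by (auto simp: mult.commute)
    with \<open>\<delta> < u - 1\<close> \<open>\<delta> < v - 1\<close> show ?thesis by (simp add: uv)
  qed
  have "compact ({1 + \<delta> .. 1 + 1 / \<delta>} \<times> {1 + \<delta> .. 1 + 1 / \<delta>})" by (intro compact_Times) auto
  then obtain p r where p: "p \<in> {1 + \<delta> .. 1 + 1 / \<delta>} \<times> {1 + \<delta> .. 1 + 1 / \<delta>}"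
    and r: "strict_mono r" and lim: "(x \<circ> r) \<longlonglongrightarrow> p"
    using x_in unfolding compact_eq_seq_compact_metric by (meson seq_compactE)
  obtain p0 p1 where pp: "p = (p0, p1)" by (cases p)
  have gt: "1 < p0" "1 < p1" using p \<delta> by (auto simp: pp)
  have lim0: "(\<lambda>k. fst (x (r k))) \<longlonglongrightarrow> p0" and lim1: "(\<lambda>k. snd (x (r k))) \<longlonglongrightarrow> p1"
    using tendsto_fst[OF lim] tendsto_snd[OF lim] by (simp_all add: pp o_def)
  have ev: "\<forall>\<^sub>F k in sequentially. i < r k + M + 1" for i
  proof (rule eventually_sequentiallyI)
    show "i < r k + M + 1" if "i \<le> k" for k using seq_suble[OF r, of k] that by simp
  qed
  have "solves A C p0 p1"
  proof (rule solves_limit[OF sol_x lim0 lim1 gt])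
    show "\<forall>\<^sub>F k in sequentially. a (r k) i = A i" for i
      using ev[of i] by eventually_elim (rule agree)
    show "\<forall>\<^sub>F k in sequentially. c (r k) i = C i" for i
      using ev[of i] by eventually_elim (rule agree)
  qed
  then have "p = q" using solves_unique[OF sol _ nonconst(1,2)] by (simp add: pp qq)
  moreover have "(x \<circ> r) k \<in> baseU" for k using Q unfolding baseU_eq x_def by simp
  ultimately show ?thesis using lim unfolding closure_sequential by blast
qed

theorem theorem3:
  shows "baseU = Phi_inv ` seqU \<union> baseC
       \<and> baseV = Phi_inv ` (seqV - seqC) \<union> baseC
       \<and> base_closure baseU = Phi_inv ` (seq_closure seqU - seqC) \<union> baseC"
proof (intro conjI)
  show "baseU = Phi_inv ` seqU \<union> baseC"
    using baseU_eq Phi_inv_image[of seqU] seqU_subset seqV_minus_seqC_subset by blast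
  show "baseV = Phi_inv ` (seqV - seqC) \<union> baseC"
    using baseV_eq Phi_inv_image[OF seqV_minus_seqC_subset] by simp
  have "seq_closure seqU - seqC \<subseteq> seqB"
    using seq_closure_seqU_subset seqV_minus_seqC_subset by blast
  then have "Phi_inv ` (seq_closure seqU - seqC) = {q \<in> baseB. Phi q \<in> seq_closure seqU - seqC}"
    by (rule Phi_inv_image)
  also have "\<dots> = {q \<in> baseB. Phi q \<in> seq_closure seqU}"
  proof -
    have "seqB \<inter> seqC = {}" by (auto simp: seqB_def)
    then show ?thesis using bij_betwE[OF bij_betw_Phi] by blast
  qed
  also have "\<dots> = closure baseU \<inter> baseB"
    using closure_imp_Phi_closure Phi_closure_imp_closure by blast
  finally have "Phi_inv ` (seq_closure seqU - seqC) \<union> baseC = closure baseU"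
    using closure_baseU_subset baseC_subset_baseU closure_subset[of baseU] by blast
  then show "base_closure baseU = Phi_inv ` (seq_closure seqU - seqC) \<union> baseC"
    by (simp add: base_closure_eq)
qed

end
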